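(* Let $B$ be a balanced polygon in $\mathbb{R}^2$ all of whose vertices have integer coordinates, and whose area is an odd integer. Then $B$ cannot be cut into an odd number of triangles of equal areas.
   Context: A plane polygon $B$ with clockwise-oriented boundary is called balanced if its edges (oriented by the orientation of the boundary) can be divided into pairs so that in each pair the two edges are parallel, equal in length and have opposite orientation. "$B$ is cut into triangles" means that $B$ is the union of finitely many triangles whose interiors are pairwise disjoint; triangles may be degenerate. *)

theory Defs
  imports "HOL-Analysis.Analysis"
begin

text \<open>
  A polygon is given by the cyclic list \<open>vs\<close> of its vertices.  Collinear consecutive edges
  (angle \<open>\<pi>\<close> at a listed vertex) are allowed, so that for instance a polyomino may be presented
  with all its boundary edges of unit length.
\<close>

fun polygonal_path :: "(real^2) list \<Rightarrow> real \<Rightarrow> real^2" where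
  "polygonal_path [] = (\<lambda>_. 0)"
| "polygonal_path [a] = linepath a a"
| "polygonal_path [a, b] = linepath a b"
| "polygonal_path (a # b # c # xs) = linepath a b +++ polygonal_path (b # c # xs)"

definition boundary_path :: "(real^2) list \<Rightarrow> real \<Rightarrow> real^2" where
  "boundary_path vs = polygonal_path (vs @ [hd vs])"

definition simple_polygon :: "(real^2) list \<Rightarrow> bool" where
  "simple_polygon vs \<longleftrightarrow> length vs \<ge> 3 \<and> simple_path (boundary_path vs)"

definition polygon_region :: "(real^2) list \<Rightarrow> (real^2) set" where
  "polygon_region vs =
     path_image (boundary_path vs) \<union> inside (path_image (boundary_path vs))"

definition edge_vec :: "(real^2) list \<Rightarrow> nat \<Rightarrow> real^2" where
  "edge_vec vs i = vs ! (Suc i mod length vs) - vs ! i"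

text \<open>
  Two oriented edges are parallel, equal in length and oppositely oriented exactly when their
  vectors are negatives of each other.
\<close>

definition balanced :: "(real^2) list \<Rightarrow> bool" where
  "balanced vs \<longleftrightarrow>
     (\<exists>P. partition_on {..<length vs} P \<and>
          (\<forall>p\<in>P. \<exists>i j. i \<noteq> j \<and> p = {i, j} \<and> edge_vec vs j = - edge_vec vs i))"

text \<open>
  Reversing the boundary negates all edge vectors, so it is irrelevant whether \<open>vs\<close> runs
  clockwise or counterclockwise.
\<close>

lemma balanced_rev_imp:
  assumes "balanced vs"
  shows "balanced (rev vs)"
proof (cases "vs = []")
  case True
  then show ?thesis using assms by simp
next
  case False
  define n where "n = length vs"
  have n: "n > 0" using False by (simp add: n_def)
  define g where "g i = (if i = n - 1 then n - 1 else n - 2 - i)" for i :: nat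
  have g_less: "g i < n" if "i < n" for i using that n by (auto simp: g_def)
  have g_g: "g (g i) = i" if "i < n" for i using that n by (auto simp: g_def)
  have bij: "bij_betw g {..<n} {..<n}"
    by (rule bij_betw_byWitness[where f' = g]) (use g_less g_g in auto)
  have edge: "edge_vec (rev vs) (g i) = - edge_vec vs i" if i: "i < n" for i
  proof (cases "i = n - 1")
    case True
    then show ?thesis using n by (simp add: edge_vec_def g_def rev_nth n_def)
  next
    case False
    then have *: "Suc i < n" using i by simp
    then have "Suc (n - 2 - i) = n - 1 - i" by simp
    moreover have "n - Suc (n - 1 - i) = i" "n - Suc (n - 2 - i) = Suc i" using * by auto
    ultimately show ?thesis using * False
      by (simp add: edge_vec_def g_def rev_nth n_def)
  qed
  obtain P where P: "partition_on {..<n} P"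
    and pair: "\<And>p. p \<in> P \<Longrightarrow> \<exists>i j. i \<noteq> j \<and> p = {i, j} \<and> edge_vec vs j = - edge_vec vs i"
    using assms unfolding balanced_def n_def by blast
  have part: "partition_on {..<n} ((`) g ` P)"
  proof -
    have "(`) g ` P - {{}} = (`) g ` P" using partition_onD3[OF P] by auto
    then show ?thesis
      using partition_on_inj_image[OF P, of g] bij by (simp add: bij_betw_def)
  qed
  have "\<exists>i j. i \<noteq> j \<and> q = {i, j} \<and> edge_vec (rev vs) j = - edge_vec (rev vs) i"
    if q: "q \<in> (`) g ` P" for q
  proof -
    obtain p where p: "p \<in> P" "q = g ` p" using q by blast
    obtain i j where ij: "i \<noteq> j" "p = {i, j}" "edge_vec vs j = - edge_vec vs i"
      using pair[OF p(1)] by blast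
    have "i < n" "j < n" using P p(1) ij(2) by (auto simp: partition_on_def)
    moreover have "g i \<noteq> g j" using calculation g_g ij(1) by metis
    ultimately show ?thesis using edge ij p(2) by (intro exI[of _ "g i"] exI[of _ "g j"]) auto
  qed
  then show ?thesis using part unfolding balanced_def n_def by auto
qed

lemma balanced_rev: "balanced (rev vs) \<longleftrightarrow> balanced vs"
  using balanced_rev_imp[of vs] balanced_rev_imp[of "rev vs"] by auto

definition triangle :: "(real^2) \<times> (real^2) \<times> (real^2) \<Rightarrow> (real^2) set" where
  "triangle = (\<lambda>(a, b, c). convex hull {a, b, c})"

text \<open>Degenerate triangles are allowed.\<close>

definition cut_into_triangles ::
    "(real^2) set \<Rightarrow> ((real^2) \<times> (real^2) \<times> (real^2)) list \<Rightarrow> bool" where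
  "cut_into_triangles B ts \<longleftrightarrow>
     B = (\<Union>t\<in>set ts. triangle t) \<and>
     (\<forall>i<length ts. \<forall>j<length ts. i \<noteq> j \<longrightarrow>
        interior (triangle (ts ! i)) \<inter> interior (triangle (ts ! j)) = {})"

abbreviation area :: "(real^2) set \<Rightarrow> real" where
  "area \<equiv> measure lebesgue"

end

theory Submission
  imports Defs "HOL-Computational_Algebra.Polynomial"
begin

text \<open>
  Let \<open>\<sigma>\<close> be a functional on oriented segments whose sum over the boundary of every degenerate
  triangle vanishes.  Its sums over the positively oriented boundaries of the triangles of a
  dissection add up to \<open>s\<close> times its sum over the edges of the polygon: away from finitely many
  points, both sides count whether the region lies to the left and to the right of an edge.  This
  gives a coefficient for every edge of the polygon, and taking for \<open>\<sigma>\<close> the coboundary of the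
  indicator function of a vertex shows that all these coefficients are equal, so that the
  orientation of the polygon never has to be determined.

  Applied to the cross product, this identity computes the area of the polygon.  Applied to Monsky's
  colouring of the plane by means of a valuation ring of the reals in which \<open>2\<close> is not a unit,
  with \<open>\<sigma>\<close> counting the edges from colour \<open>A\<close> to colour \<open>B\<close> with sign, it shows that the signed
  count over the polygon is zero: triangles of area \<open>k/m\<close> with \<open>m\<close> odd are never rainbow.  The
  count has to be taken as an integer and not, as in Monsky's theorem, modulo \<open>2\<close>.  For lattice
  polygons it only depends on parities, and a suitable combination of three such counts (for
  translated and reflected colourings) has the same behaviour modulo \<open>4\<close> as twice the area when
  two consecutive steps of a lattice path are exchanged.  The steps of a balanced polygon can be
  rearranged to a path that retraces every step at once, so that twice its area is congruent to the
  combined count modulo \<open>4\<close>.  Since the latter vanishes, the area is even.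
\<close>

section \<open>Oriented segments and additive functionals\<close>

definition cross2 :: "real^2 \<Rightarrow> real^2 \<Rightarrow> real" where
  "cross2 u v = u$1 * v$2 - u$2 * v$1"

definition orient :: "real^2 \<Rightarrow> real^2 \<Rightarrow> real^2 \<Rightarrow> real" where
  "orient a b c = cross2 (b - a) (c - a)"

text \<open>The quarter turn to the left: for small positive \<open>r\<close>, the point
  \<open>x + r *\<^sub>R rot u\<close> lies just left of the line through \<open>x\<close> directed
  along \<open>u\<close>.\<close>

definition rot :: "real^2 \<Rightarrow> real^2" where
  "rot u = (\<chi> i. if i = 1 then - (u$2) else u$1)"

lemmas plane_simps = cross2_def orient_def rot_def vec_eq_iff forall_2 inner_vec_def sum_2

lemma orient_rotate: "orient b c a = orient a b c"
  and orient_swap: "orient a c b = - orient a b c"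
  and orient_sum: "orient a b x + orient b c x + orient c a x = orient a b c"
  and orient_edge_left: "orient p q p = 0"
  and orient_edge_right: "orient p q q = 0"
  and orient_rot: "orient p q (x + r *\<^sub>R rot u) = orient p q x + r * (u \<bullet> (q - p))"
  and cross2_self: "cross2 u u = 0"
  by (auto simp: plane_simps algebra_simps)

lemma orient_affine:
  assumes "s + t = 1"
  shows "orient p q (s *\<^sub>R x + t *\<^sub>R y) = s * orient p q x + t * orient p q y"
proof -
  have s: "s = 1 - t" using assms by simp
  show ?thesis unfolding s by (simp add: plane_simps algebra_simps)
qed

lemma cross2_eq_0:
  assumes "u \<noteq> 0" "cross2 u v = 0"
  obtains k where "v = k *\<^sub>R u"
proof -
  have "u$1 \<noteq> 0 \<or> u$2 \<noteq> 0" using assms(1) by (auto simp: plane_simps)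
  then show thesis
  proof
    assume "u$1 \<noteq> 0"
    then have "v = (v$1 / u$1) *\<^sub>R u"
      using assms(2) by (auto simp: plane_simps field_simps)
    then show thesis by (rule that)
  next
    assume "u$2 \<noteq> 0"
    then have "v = (v$2 / u$2) *\<^sub>R u"
      using assms(2) by (auto simp: plane_simps field_simps)
    then show thesis by (rule that)
  qed
qed

lemma cross2_scaleR: "cross2 u (k *\<^sub>R v) = k * cross2 u v" "cross2 (k *\<^sub>R u) v = k * cross2 u v"
  by (auto simp: plane_simps algebra_simps)

lemma parallel_inner_nonzero:
  assumes "u \<noteq> 0" "v \<noteq> 0" "cross2 u v = 0"
  shows "u \<bullet> v \<noteq> 0"
proof -
  obtain k where "v = k *\<^sub>R u" using cross2_eq_0 assms by blast
  with assms show ?thesis by auto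
qed

lemma orient_eq_0_line:
  assumes "a \<noteq> b" "orient a b x = 0"
  obtains k where "x = a + k *\<^sub>R (b - a)"
proof -
  obtain k where "x - a = k *\<^sub>R (b - a)"
    using cross2_eq_0[of "b - a" "x - a"] assms by (auto simp: orient_def)
  then show thesis using that[of k] by (simp add: algebra_simps)
qed

lemma orient_eq_0_collinear: "orient a b c = 0 \<longleftrightarrow> collinear {a, b, c}"
proof
  assume 0: "orient a b c = 0"
  show "collinear {a, b, c}"
  proof (cases "a = b")
    case False
    then obtain k where "c = a + k *\<^sub>R (b - a)" using orient_eq_0_line 0 by blast
    then have "\<exists>u. c = u *\<^sub>R a + (1 - u) *\<^sub>R b"
      by (intro exI[of _ "1 - k"]) (simp add: algebra_simps)
    moreover have "{a, b, c} = {a, c, b}" by auto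
    ultimately show ?thesis using collinear_3_expand[of a c b] by auto
  qed auto
next
  assume "collinear {a, b, c}"
  moreover have "{a, b, c} = {a, c, b}" by auto
  ultimately consider "a = b" | u where "c = u *\<^sub>R a + (1 - u) *\<^sub>R b"
    using collinear_3_expand[of a c b] by auto
  then show "orient a b c = 0"
    by cases (auto simp: orient_affine orient_edge_left orient_edge_right, simp add: orient_def cross2_def)
qed

lemma open_segment_orient: "x \<in> open_segment p q \<Longrightarrow> orient p q x = 0"
  by (auto simp: in_segment orient_affine orient_edge_left orient_edge_right)

text \<open>A segment contributes only where it runs along \<open>u\<close> through
  \<open>x\<close>, with sign 1 or -1 for equal or opposite direction. This is the jump at
  \<open>x\<close>, from the right of \<open>u\<close> to its left, of a region bounded by the
  segment and lying on its left.\<close>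

definition crossing :: "real^2 \<Rightarrow> real^2 \<Rightarrow> real^2 \<Rightarrow> real^2 \<Rightarrow> real" where
  "crossing x u a b =
     (if x \<in> open_segment a b \<and> cross2 u (b - a) = 0 then sgn (u \<bullet> (b - a)) else 0)"

text \<open>Relations hold only within a single line: there \<open>\<sigma>\<close> is the
  difference of a potential, while nondegenerate triangles remain unconstrained.\<close>

definition chain_additive :: "(real^2 \<Rightarrow> real^2 \<Rightarrow> real) \<Rightarrow> bool" where
  "chain_additive \<sigma> \<longleftrightarrow> (\<forall>a b c. orient a b c = 0 \<longrightarrow> \<sigma> a b + \<sigma> b c + \<sigma> c a = 0)"

lemma chain_additive_refl: "chain_additive \<sigma> \<Longrightarrow> \<sigma> a a = 0"
  using orient_edge_left[of a a] unfolding chain_additive_def by fastforce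

lemma chain_additive_swap:
  assumes "chain_additive \<sigma>"
  shows "\<sigma> b a = - \<sigma> a b"
proof -
  have "\<sigma> a b + \<sigma> b a + \<sigma> a a = 0"
    using assms orient_edge_left unfolding chain_additive_def by blast
  then show ?thesis using chain_additive_refl[OF assms] by simp
qed

lemma open_segment_on_line:
  assumes "u \<noteq> 0"
  shows "p + t *\<^sub>R u \<in> open_segment (p + \<alpha> *\<^sub>R u) (p + \<beta> *\<^sub>R u) \<longleftrightarrow>
    \<alpha> < t \<and> t < \<beta> \<or> \<beta> < t \<and> t < \<alpha>"
proof -
  define f where "f = (\<lambda>t. t *\<^sub>R u)"
  have f: "linear f" "inj f" using assms
    by (auto simp: f_def inj_on_def scaleR_left_distrib intro!: linearI)
  have "p + t *\<^sub>R u \<in> open_segment (p + \<alpha> *\<^sub>R u) (p + \<beta> *\<^sub>R u) \<longleftrightarrow> f t \<in> open_segment (f \<alpha>) (f \<beta>)"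
    using open_segment_translation_eq[of p "f t" "f \<alpha>" "f \<beta>"] by (simp add: f_def)
  also have "\<dots> \<longleftrightarrow> t \<in> open_segment \<alpha> \<beta>"
    using open_segment_linear_image[OF f, of \<alpha> \<beta>] f(2) by (auto simp: inj_image_mem_iff)
  finally show ?thesis by (auto simp: open_segment_eq_real_ivl)
qed

text \<open>Moving along \<open>u\<close> through \<open>p\<close>, the value changes only when an
  endpoint is passed. A start at \<open>p\<close> gives 1 and an end at \<open>p\<close> gives -1
  for both directions of the segment, since the sign in \<open>crossing\<close> reverses together
  with the side of \<open>p\<close> on which the segment lies.\<close>

lemma eventually_crossing_jump:
  assumes "u \<noteq> 0" "a \<noteq> b"
  shows "\<forall>\<^sub>F t in at_right 0. crossing (p + t *\<^sub>R u) u a b - crossing (p - t *\<^sub>R u) u a b =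
     (if cross2 u (b - a) = 0 then of_bool (a = p) - of_bool (b = p) else 0)"
proof (cases "cross2 u (b - a) = 0 \<and> cross2 u (a - p) = 0")
  case False
  \<comment> \<open>A segment parallel to \<open>u\<close> but off the line through \<open>p\<close>
    never meets that line.\<close>
  have off: "p + t *\<^sub>R u \<notin> open_segment a b" if par: "cross2 u (b - a) = 0" for t
  proof
    assume "p + t *\<^sub>R u \<in> open_segment a b"
    then have "orient a b (p + t *\<^sub>R u) = 0" by (rule open_segment_orient)
    moreover obtain k where k: "b - a = k *\<^sub>R u" using cross2_eq_0 assms(1) par by blast
    moreover have "k \<noteq> 0" using k assms by auto
    ultimately have "cross2 u (p + t *\<^sub>R u - a) = 0"
      by (simp add: orient_def cross2_scaleR)
    then have "cross2 u (a - p) = 0" by (simp add: plane_simps algebra_simps)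
    with par False show False by simp
  qed
  from off off[of "- _"] have *: "cross2 u (b - a) = 0 \<Longrightarrow> crossing (p + t *\<^sub>R u) u a b - crossing (p - t *\<^sub>R u) u a b = 0" for t
    by (simp add: crossing_def)
  have "a \<noteq> p" "b \<noteq> p" if "cross2 u (b - a) = 0"
  proof -
    show "a \<noteq> p" using that False by (auto simp: plane_simps)
    show "b \<noteq> p" using that False by (auto simp: plane_simps algebra_simps)
  qed
  then show ?thesis using * by (auto simp: crossing_def)
next
  case True
  obtain \<alpha> where "a - p = \<alpha> *\<^sub>R u" using cross2_eq_0 assms True by blast
  then have a: "a = p + \<alpha> *\<^sub>R u" by (simp add: algebra_simps)
  obtain k where k: "b - a = k *\<^sub>R u" using cross2_eq_0 assms True by blast
  define \<beta> where "\<beta> = \<alpha> + k"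
  have b: "b = p + \<beta> *\<^sub>R u" using a k by (simp add: \<beta>_def algebra_simps)
  have neq: "\<alpha> \<noteq> \<beta>" using assms a b by auto
  have sg: "sgn (u \<bullet> (b - a)) = sgn (\<beta> - \<alpha>)"
    using assms(1) by (simp add: k \<beta>_def sgn_mult)
  have sp: "p + t *\<^sub>R u \<in> open_segment a b \<longleftrightarrow> \<alpha> < t \<and> t < \<beta> \<or> \<beta> < t \<and> t < \<alpha>" for t
    unfolding a b by (rule open_segment_on_line[OF assms(1)])
  from sp[of "- _"] have sm: "p - t *\<^sub>R u \<in> open_segment a b \<longleftrightarrow> \<alpha> < -t \<and> -t < \<beta> \<or> \<beta> < -t \<and> -t < \<alpha>" for t
    by simp
  have ap: "a = p \<longleftrightarrow> \<alpha> = 0" "b = p \<longleftrightarrow> \<beta> = 0" using a b assms by auto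
  \<comment> \<open>Parameters below \<open>m\<close> do not reach any endpoint other than
    \<open>p\<close>; an endpoint at \<open>p\<close> imposes no bound and gets the default
    1.\<close>
  define m where "m = min (if \<alpha> = 0 then 1 else \<bar>\<alpha>\<bar>) (if \<beta> = 0 then 1 else \<bar>\<beta>\<bar>)"
  have m0: "m > 0" by (simp add: m_def)
  have m1: "\<alpha> = 0 \<or> m \<le> \<bar>\<alpha>\<bar>" "\<beta> = 0 \<or> m \<le> \<bar>\<beta>\<bar>"
    by (auto simp: m_def)
  have "\<forall>\<^sub>F t in at_right 0. 0 < t \<and> t < m"
    using m0 by (auto simp: eventually_at_right intro!: exI[of _ m])
  then show ?thesis
  proof eventually_elim
    case (elim t)
    consider "\<alpha> < \<beta>" | "\<beta> < \<alpha>" using neq by linarith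
    then show ?case
      using elim m1 True unfolding crossing_def sp sm sg ap
      by cases (auto split: if_splits)
  qed
qed

section \<open>Boundaries of chains of segments, line by line\<close>

lemma affine_hull_reparam:
  fixes p u :: "real^2"
  assumes "k \<noteq> 0"
  shows "affine hull {p + \<alpha> *\<^sub>R u, p + (\<alpha> + k) *\<^sub>R u} = affine hull {p, p + u}"
proof -
  have d: "p + (\<alpha> + k) *\<^sub>R u - (p + \<alpha> *\<^sub>R u) = k *\<^sub>R u" "p + u - p = u"
    by (simp_all add: algebra_simps)
  have "range (\<lambda>t. p + \<alpha> *\<^sub>R u + t *\<^sub>R (k *\<^sub>R u)) = (\<lambda>t. p + t *\<^sub>R u) ` range (\<lambda>t. \<alpha> + k * t)"
    by (auto simp: image_image algebra_simps)
  also have "range (\<lambda>t. \<alpha> + k * t) = UNIV"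
    using assms by (auto simp: surj_def intro!: exI[of _ "(_ - \<alpha>) / k"])
  finally show ?thesis unfolding affine_hull_2_alt d .
qed

lemma parallel_to_line_iff:
  fixes a b p u :: "real^2"
  assumes "u \<noteq> 0" "a \<noteq> b" "a = p \<or> b = p"
  shows "cross2 u (b - a) = 0 \<longleftrightarrow> affine hull {a, b} = affine hull {p, p + u}"
proof
  assume 0: "cross2 u (b - a) = 0"
  obtain k where k: "b - a = k *\<^sub>R u" using cross2_eq_0 assms 0 by blast
  then have k0: "k \<noteq> 0" using assms by auto
  from assms(3) show "affine hull {a, b} = affine hull {p, p + u}"
  proof
    assume "a = p"
    with k have "a = p + 0 *\<^sub>R u" "b = p + (0 + k) *\<^sub>R u" by (auto simp: algebra_simps)
    then show ?thesis using affine_hull_reparam[OF k0] by metis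
  next
    assume "b = p"
    with k have "a = p + (-k) *\<^sub>R u" "b = p + (-k + k) *\<^sub>R u" by (auto simp: algebra_simps)
    then show ?thesis using affine_hull_reparam[OF k0] by metis
  qed
next
  assume eq: "affine hull {a, b} = affine hull {p, p + u}"
  have "a \<in> affine hull {p, p + u}" "b \<in> affine hull {p, p + u}"
    using eq hull_subset[of "{a,b}" affine] by auto
  then obtain s t where "a = p + s *\<^sub>R u" "b = p + t *\<^sub>R u"
    by (auto simp: affine_hull_2_alt)
  then have "b - a = (t - s) *\<^sub>R u" by (simp add: algebra_simps)
  then show "cross2 u (b - a) = 0" by (simp add: cross2_scaleR cross2_self)
qed

lemma eventually_at_right_notin_finite:
  fixes S :: "real set"
  assumes "finite S"
  shows "\<forall>\<^sub>F t in at_right a. t \<notin> S"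
proof -
  have "open (- (S - {a}))" using assms by (intro open_Compl finite_imp_closed finite_Diff)
  then have "\<forall>\<^sub>F t in at_right a. t \<in> - (S - {a})"
    by (intro eventually_at_topological[THEN iffD2]) auto
  with eventually_at_right_less[of a] show ?thesis
    by eventually_elim auto
qed

lemma eventually_line_notin_finite:
  fixes u :: "real^2"
  assumes "finite Z" "u \<noteq> 0"
  shows "\<forall>\<^sub>F t in at_right (0::real). p + t *\<^sub>R u \<notin> Z"
proof -
  have "inj (\<lambda>t. p + t *\<^sub>R u)" using assms by (auto intro: injI)
  then have "finite ((\<lambda>t. p + t *\<^sub>R u) -` Z)" using assms by (intro finite_vimageI)
  from eventually_at_right_notin_finite[OF this] show ?thesis by simp
qed

text \<open>A weighted chain of segments that generic points do not see: outside the finite set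
  \<open>Z\<close>, the segments through a point cancel in every direction.\<close>

locale vanishing_crossings =
  fixes I :: "'i set" and a b :: "'i \<Rightarrow> real^2" and n :: "'i \<Rightarrow> real" and Z :: "(real^2) set"
  assumes finI: "finite I" and finZ: "finite Z"
    and nondeg: "\<And>i. i \<in> I \<Longrightarrow> a i \<noteq> b i"
    and crossings: "\<And>x u. x \<notin> Z \<Longrightarrow> u \<noteq> 0 \<Longrightarrow> (\<Sum>i\<in>I. n i * crossing x u (a i) (b i)) = 0"
begin

text \<open>Close to \<open>p\<close>, the points on both sides of it along \<open>u\<close> avoid
  \<open>Z\<close>, so both crossing sums vanish. Their difference is the sum of the jumps at
  \<open>p\<close>.\<close>

lemma boundary_along_direction:
  assumes "u \<noteq> 0"
  shows "(\<Sum>i\<in>I. n i * (if cross2 u (b i - a i) = 0 then of_bool (a i = p) - of_bool (b i = p) else 0)) = 0"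
proof -
  have "\<forall>\<^sub>F t in at_right (0::real). p + t *\<^sub>R u \<notin> Z" "\<forall>\<^sub>F t in at_right (0::real). p - t *\<^sub>R u \<notin> Z"
    using eventually_line_notin_finite[OF finZ assms, of p]
      eventually_line_notin_finite[OF finZ, of "-u" p] assms by auto
  moreover have "\<forall>\<^sub>F t in at_right 0. \<forall>i\<in>I. crossing (p + t *\<^sub>R u) u (a i) (b i) - crossing (p - t *\<^sub>R u) u (a i) (b i) =
     (if cross2 u (b i - a i) = 0 then of_bool (a i = p) - of_bool (b i = p) else 0)"
    by (intro eventually_ball_finite[OF finI] ballI eventually_crossing_jump assms nondeg)
  ultimately have "\<forall>\<^sub>F t in at_right (0::real). (\<Sum>i\<in>I. n i * (if cross2 u (b i - a i) = 0 then of_bool (a i = p) - of_bool (b i = p) else 0)) = 0"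
  proof eventually_elim
    case (elim t)
    then have "(\<Sum>i\<in>I. n i * (if cross2 u (b i - a i) = 0 then of_bool (a i = p) - of_bool (b i = p) else 0)) =
       (\<Sum>i\<in>I. n i * crossing (p + t *\<^sub>R u) u (a i) (b i)) - (\<Sum>i\<in>I. n i * crossing (p - t *\<^sub>R u) u (a i) (b i))"
      by (simp add: sum_subtractf[symmetric] right_diff_distrib[symmetric])
    with elim crossings assms show ?case by simp
  qed
  then show ?thesis by simp
qed

text \<open>A segment with endpoint \<open>p\<close> is parallel to \<open>u\<close> exactly when it
  spans the line through \<open>p\<close> along \<open>u\<close>, so the condition for a direction
  becomes one for a single line.\<close>

lemma boundary_along_line:
  assumes "p \<noteq> q" "affine hull {p, q} = \<l>"
  shows "(\<Sum>i | i \<in> I \<and> affine hull {a i, b i} = \<l>. n i * (of_bool (b i = p) - of_bool (a i = p))) = 0"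
proof -
  define u where "u = q - p"
  have u: "u \<noteq> 0" "q = p + u" using assms by (auto simp: u_def)
  have "(\<Sum>i | i \<in> I \<and> affine hull {a i, b i} = \<l>. n i * (of_bool (b i = p) - of_bool (a i = p))) =
    (\<Sum>i\<in>I. if affine hull {a i, b i} = \<l> then n i * (of_bool (b i = p) - of_bool (a i = p)) else 0)"
    using finI by (simp add: sum.inter_filter)
  also have "\<dots> = (\<Sum>i\<in>I. - (n i * (if cross2 u (b i - a i) = 0 then of_bool (a i = p) - of_bool (b i = p) else 0)))"
  proof (rule sum.cong)
    fix i assume i: "i \<in> I"
    show "(if affine hull {a i, b i} = \<l> then n i * (of_bool (b i = p) - of_bool (a i = p)) else 0) =
      - (n i * (if cross2 u (b i - a i) = 0 then of_bool (a i = p) - of_bool (b i = p) else 0))"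
    proof (cases "a i = p \<or> b i = p")
      case True
      from parallel_to_line_iff[OF u(1) nondeg[OF i] True] show ?thesis
        using assms(2) u(2) by auto
    qed auto
  qed auto
  also have "\<dots> = 0" using boundary_along_direction[OF u(1), of p] by (simp add: sum_negf)
  finally show ?thesis .
qed

text \<open>The segments are grouped by the lines that they span. On one line
  \<open>\<sigma>\<close> is the difference of the potential \<open>\<sigma> p0\<close>, and
  summation by parts moves the weights into the boundary at each vertex, which is zero.\<close>

lemma chain_vanishes:
  assumes "chain_additive \<sigma>"
  shows "(\<Sum>i\<in>I. n i * \<sigma> (a i) (b i)) = 0"
proof -
  define line where "line i = affine hull {a i, b i}" for i
  have "(\<Sum>i\<in>{i\<in>I. line i = \<l>}. n i * \<sigma> (a i) (b i)) = 0" if l: "\<l> \<in> line ` I" for \<l>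
  proof -
    obtain j where j: "j \<in> I" "\<l> = line j" using l by auto
    define p0 where "p0 = a j"
    define J where "J = {i\<in>I. line i = \<l>}"
    define V where "V = a ` J \<union> b ` J"
    have fin: "finite J" "finite V" using finI by (auto simp: J_def V_def)
    have mem: "a i \<in> \<l>" "b i \<in> \<l>" if "i \<in> J" for i
      using that by (auto simp: J_def line_def intro: hull_inc)
    have coll: "orient p0 x y = 0" if "x \<in> \<l>" "y \<in> \<l>" for x y
    proof -
      have "collinear \<l>" unfolding j line_def by (simp add: collinear_affine_hull_collinear)
      moreover have "{p0, x, y} \<subseteq> \<l>" using that mem[of j] j by (auto simp: p0_def J_def)
      ultimately show ?thesis using orient_eq_0_collinear collinear_subset by blast
    qed
    have bd: "(\<Sum>i\<in>J. n i * (of_bool (b i = p) - of_bool (a i = p))) = 0" if "p \<in> V" for p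
    proof -
      obtain i where i: "i \<in> J" "p = a i \<or> p = b i" using \<open>p \<in> V\<close> by (auto simp: V_def)
      then have "a i \<noteq> b i" "line i = \<l>" using nondeg by (auto simp: J_def)
      with i mem[of i] boundary_along_line[of "a i" "b i" \<l>] boundary_along_line[of "b i" "a i" \<l>]
      show ?thesis by (auto simp: J_def line_def insert_commute)
    qed
    have "\<sigma> (a i) (b i) = (\<Sum>p\<in>V. \<sigma> p0 p * (of_bool (b i = p) - of_bool (a i = p)))" if i: "i \<in> J" for i
    proof -
      have "\<sigma> p0 (a i) + \<sigma> (a i) (b i) + \<sigma> (b i) p0 = 0"
        using assms coll[of "a i" "b i"] mem[OF i] unfolding chain_additive_def by blast
      then have "\<sigma> (a i) (b i) = \<sigma> p0 (b i) - \<sigma> p0 (a i)"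
        using chain_additive_swap[OF assms, of "b i" p0] by simp
      also have "\<dots> = (\<Sum>p\<in>V. \<sigma> p0 p * of_bool (b i = p)) - (\<Sum>p\<in>V. \<sigma> p0 p * of_bool (a i = p))"
        using fin i by (simp add: V_def of_bool_def if_distrib[where f="\<lambda>x. _ * x"] sum.delta cong: if_cong)
      finally show ?thesis by (simp add: right_diff_distrib sum_subtractf)
    qed
    then have "(\<Sum>i\<in>J. n i * \<sigma> (a i) (b i)) =
        (\<Sum>i\<in>J. \<Sum>p\<in>V. n i * (\<sigma> p0 p * (of_bool (b i = p) - of_bool (a i = p))))"
      by (intro sum.cong) (auto simp: sum_distrib_left)
    also have "\<dots> = (\<Sum>p\<in>V. \<sigma> p0 p * (\<Sum>i\<in>J. n i * (of_bool (b i = p) - of_bool (a i = p))))"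
      by (subst sum.swap) (simp add: sum_distrib_left mult_ac)
    also have "\<dots> = 0" using bd by simp
    finally show ?thesis by (simp add: J_def)
  qed
  then have "(\<Sum>\<l>\<in>line ` I. \<Sum>i\<in>{i\<in>I. line i = \<l>}. n i * \<sigma> (a i) (b i)) = 0"
    by simp
  then show ?thesis using sum.group[of I "line ` I" line "\<lambda>i. n i * \<sigma> (a i) (b i)"] finI by simp
qed

end

section \<open>One-sided germs of triangles\<close>

text \<open>The one-sided germ of \<open>S\<close> at \<open>x\<close>; the right side of
  \<open>u\<close> is the left side of \<open>- u\<close>. For a general set it can fail for
  \<open>S\<close> and for the complement at once, hence the dichotomies proved for
  triangles.\<close>

definition left_germ :: "(real^2) set \<Rightarrow> real^2 \<Rightarrow> real^2 \<Rightarrow> bool" where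
  "left_germ S x u \<longleftrightarrow> (\<forall>\<^sub>F r in at_right 0. x + r *\<^sub>R rot u \<in> S)"

lemma left_germ_mono: "left_germ S x u \<Longrightarrow> S \<subseteq> T \<Longrightarrow> left_germ T x u"
  unfolding left_germ_def by (auto elim: eventually_mono)

lemma left_germ_Int: "left_germ (S \<inter> T) x u \<longleftrightarrow> left_germ S x u \<and> left_germ T x u"
  unfolding left_germ_def by (simp add: eventually_conj_iff)

lemma not_left_germ_empty: "\<not> left_germ {} x u"
  by (simp add: left_germ_def)

lemma left_germ_disjoint: "left_germ S x u \<Longrightarrow> left_germ T x u \<Longrightarrow> S \<inter> T \<noteq> {}"
  using left_germ_Int[of S T x u] not_left_germ_empty[of x u] by auto

lemma left_germ_open:
  assumes "open S" "x \<in> S"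
  shows "left_germ S x u"
proof -
  have "((\<lambda>r. x + r *\<^sub>R rot u) \<longlongrightarrow> x + 0 *\<^sub>R rot u) (at_right 0)"
    by (intro tendsto_intros)
  with assms show ?thesis unfolding left_germ_def by (auto dest: topological_tendstoD)
qed

lemma rot_scaleR: "rot (k *\<^sub>R u) = k *\<^sub>R rot u"
  by (simp add: rot_def vec_eq_iff)

lemma left_germ_scaleR:
  assumes "k > 0"
  shows "left_germ S x (k *\<^sub>R u) \<longleftrightarrow> left_germ S x u"
proof -
  have *: "left_germ S x (k *\<^sub>R u)" if k: "k > 0" "left_germ S x u" for k u
  proof -
    obtain b where "b > 0" "\<forall>r>0. r < b \<longrightarrow> x + r *\<^sub>R rot u \<in> S"
      using k unfolding left_germ_def eventually_at_right_field by blast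
    with \<open>k > 0\<close> show ?thesis
      unfolding left_germ_def eventually_at_right_field rot_scaleR
      by (intro exI[of _ "b / k"]) (auto simp: field_simps)
  qed
  from *[of k u] *[of "1 / k" "k *\<^sub>R u"] assms show ?thesis by auto
qed

section \<open>Triangles as intersections of half-planes\<close>

lemma orient_convex_comb:
  assumes "r + s + t = 1"
  shows "orient a b (r *\<^sub>R a + s *\<^sub>R b + t *\<^sub>R c) = t * orient a b c"
proof -
  have r: "r = 1 - s - t" using assms by simp
  show ?thesis unfolding r by (simp add: plane_simps algebra_simps)
qed

lemma barycentric:
  assumes "orient a b c \<noteq> 0"
  shows "(orient b c x / orient a b c) *\<^sub>R a + (orient c a x / orient a b c) *\<^sub>R b
     + (orient a b x / orient a b c) *\<^sub>R c = x" (is "?y = x")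
proof -
  have "orient a b c *\<^sub>R x = orient b c x *\<^sub>R a + orient c a x *\<^sub>R b + orient a b x *\<^sub>R c"
    by (simp add: plane_simps algebra_simps)
  also have "\<dots> = orient a b c *\<^sub>R ?y"
    using assms by (simp add: scaleR_right_distrib)
  finally show ?thesis using assms by simp
qed

lemma mem_triangle_iff:
  assumes "orient a b c > 0"
  shows "x \<in> convex hull {a, b, c} \<longleftrightarrow> orient a b x \<ge> 0 \<and> orient b c x \<ge> 0 \<and> orient c a x \<ge> 0"
proof
  assume "x \<in> convex hull {a, b, c}"
  then obtain r s t where *: "0 \<le> r" "0 \<le> s" "0 \<le> t" "r + s + t = 1"
      and x: "x = r *\<^sub>R a + s *\<^sub>R b + t *\<^sub>R c"
    by (auto simp: convex_hull_3)
  have "orient a b x = t * orient a b c" unfolding x using * by (simp add: orient_convex_comb)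
  moreover have "orient b c x = r * orient a b c"
  proof -
    have "x = s *\<^sub>R b + t *\<^sub>R c + r *\<^sub>R a" by (simp add: x)
    then show ?thesis using * orient_convex_comb[of s t r b c a] by (simp add: orient_rotate)
  qed
  moreover have "orient c a x = s * orient a b c"
  proof -
    have "x = t *\<^sub>R c + r *\<^sub>R a + s *\<^sub>R b" by (simp add: x)
    then show ?thesis using * orient_convex_comb[of t r s c a b] by (simp add: orient_rotate)
  qed
  ultimately show "orient a b x \<ge> 0 \<and> orient b c x \<ge> 0 \<and> orient c a x \<ge> 0"
    using * assms by simp
next
  assume *: "orient a b x \<ge> 0 \<and> orient b c x \<ge> 0 \<and> orient c a x \<ge> 0"
  have "orient b c x / orient a b c + orient c a x / orient a b c + orient a b x / orient a b c = 1"
    using assms orient_sum[of a b x c] by (simp add: field_simps)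
  then show "x \<in> convex hull {a, b, c}"
    unfolding convex_hull_3 mem_Collect_eq using assms * barycentric[of a b c x]
    by (intro exI[of _ "orient b c x / orient a b c"] exI[of _ "orient c a x / orient a b c"]
        exI[of _ "orient a b x / orient a b c"] conjI) simp_all
qed

lemma open_orient: "open {y. orient p q y > 0}"
  unfolding orient_def cross2_def
  by (rule open_Collect_less) (auto intro!: continuous_intros)

lemma mem_interior_triangle:
  assumes "orient a b x > 0" "orient b c x > 0" "orient c a x > 0"
  shows "x \<in> interior (convex hull {a, b, c})"
proof (rule interiorI)
  have D: "orient a b c > 0" using assms orient_sum[of a b x c] by simp
  show "open {y. orient a b y > 0 \<and> orient b c y > 0 \<and> orient c a y > 0}"
    by (intro open_Collect_conj open_orient)
  show "{y. orient a b y > 0 \<and> orient b c y > 0 \<and> orient c a y > 0} \<subseteq> convex hull {a, b, c}"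
    unfolding subset_iff mem_Collect_eq mem_triangle_iff[OF D] by (simp add: less_imp_le)
qed (use assms in auto)

text \<open>On the line through \<open>p\<close> and \<open>q\<close>, a step to the left of
  \<open>u\<close> changes \<open>orient\<close> by a positive multiple of
  \<open>u \<bullet> (q - p)\<close>; off the line continuity decides.\<close>

lemma eventually_orient_pos:
  assumes "orient p q x > 0 \<or> orient p q x = 0 \<and> u \<bullet> (q - p) > 0"
  shows "\<forall>\<^sub>F r in at_right 0. orient p q (x + r *\<^sub>R rot u) > 0"
  using assms
proof
  assume *: "orient p q x > 0"
  have "((\<lambda>r. orient p q x + r * (u \<bullet> (q - p))) \<longlongrightarrow> orient p q x + 0 * (u \<bullet> (q - p))) (at_right 0)"
    by (intro tendsto_intros)
  then show ?thesis unfolding orient_rot by (rule order_tendstoD) (use * in simp)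
next
  assume "orient p q x = 0 \<and> u \<bullet> (q - p) > 0"
  with eventually_at_right_less[of "0::real"] show ?thesis
    by (auto elim!: eventually_mono simp: orient_rot)
qed

lemma eventually_orient_neg:
  assumes "orient p q x < 0 \<or> orient p q x = 0 \<and> u \<bullet> (q - p) < 0"
  shows "\<forall>\<^sub>F r in at_right 0. orient p q (x + r *\<^sub>R rot u) < 0"
proof -
  have "\<forall>\<^sub>F r in at_right 0. orient q p (x + r *\<^sub>R rot u) > 0"
  proof (rule eventually_orient_pos)
    have "orient q p x = - orient p q x" by (simp add: plane_simps algebra_simps)
    moreover have "u \<bullet> (p - q) = - (u \<bullet> (q - p))" by (simp add: inner_diff_right)
    ultimately show "orient q p x > 0 \<or> orient q p x = 0 \<and> u \<bullet> (p - q) > 0" using assms by simp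
  qed
  moreover have "orient q p y = - orient p q y" for y by (simp add: plane_simps algebra_simps)
  ultimately show ?thesis by simp
qed

text \<open>A positively oriented triangle lies to the left of its edges, so the left of
  \<open>u\<close> is inside or outside according to whether \<open>u\<close> points along or
  against \<open>b - a\<close>. The other two edges miss \<open>x\<close>.\<close>

lemma left_germ_triangle_edge:
  assumes D: "orient a b c > 0" and d: "orient a b x = 0" "orient b c x > 0" "orient c a x > 0"
    and u: "u \<noteq> 0" and par: "x \<in> open_segment a b \<longrightarrow> cross2 u (b - a) = 0"
  defines "T \<equiv> convex hull {a, b, c}"
  shows "left_germ (interior T) x u \<or> left_germ (- T) x u"
    and "of_bool (left_germ T x u) - of_bool (left_germ T x (- u)) =
      crossing x u a b + crossing x u b c + crossing x u c a"
proof -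
  have ab: "a \<noteq> b" using D by (auto simp: orient_def cross2_def)
  have "x = (orient b c x / orient a b c) *\<^sub>R a + (orient c a x / orient a b c) *\<^sub>R b"
    using barycentric[of a b c x] D d(1) by simp
  moreover have "orient b c x / orient a b c = 1 - orient c a x / orient a b c"
    using orient_sum[of a b x c] d D by (simp add: field_simps)
  moreover have "0 < orient c a x / orient a b c" "orient c a x / orient a b c < 1"
    using orient_sum[of a b x c] d D by (simp_all add: field_simps)
  ultimately have op: "x \<in> open_segment a b" unfolding in_segment using ab by metis
  note par = mp[OF par op]
  have ne: "u \<bullet> (b - a) \<noteq> 0" using parallel_inner_nonzero[OF u _ par] ab by simp
  have cr: "crossing x u a b + crossing x u b c + crossing x u c a = sgn (u \<bullet> (b - a))"
    using op par d open_segment_orient[of x b c] open_segment_orient[of x c a]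
    by (auto simp: crossing_def)
  have pos: "left_germ (interior T) x v" if "v \<bullet> (b - a) > 0" for v
  proof -
    have "\<forall>\<^sub>F r in at_right 0. orient a b (x + r *\<^sub>R rot v) > 0"
      "\<forall>\<^sub>F r in at_right 0. orient b c (x + r *\<^sub>R rot v) > 0"
      "\<forall>\<^sub>F r in at_right 0. orient c a (x + r *\<^sub>R rot v) > 0"
      using that d by (auto intro!: eventually_orient_pos)
    then show ?thesis unfolding left_germ_def T_def
      by eventually_elim (rule mem_interior_triangle)
  qed
  have neg: "left_germ (- T) x v" if "v \<bullet> (b - a) < 0" for v
  proof -
    have "\<forall>\<^sub>F r in at_right 0. orient a b (x + r *\<^sub>R rot v) < 0"
      using that d by (auto intro!: eventually_orient_neg)
    then show ?thesis unfolding left_germ_def T_def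
      by eventually_elim (use mem_triangle_iff[OF D] in force)
  qed
  show "left_germ (interior T) x u \<or> left_germ (- T) x u" using pos[of u] neg[of u] ne by linarith
  have pos': "left_germ T x v" if "v \<bullet> (b - a) > 0" for v
    using pos[OF that] interior_subset by (rule left_germ_mono)
  have neg': "\<not> left_germ T x v" if "v \<bullet> (b - a) < 0" for v
    using left_germ_disjoint[OF _ neg[OF that], of T] by blast
  have "left_germ T x u \<and> \<not> left_germ T x (-u) \<and> u \<bullet> (b - a) > 0 \<or>
    left_germ T x (-u) \<and> \<not> left_germ T x u \<and> u \<bullet> (b - a) < 0"
  proof (cases "u \<bullet> (b - a) > 0")
    case True
    then show ?thesis using pos'[of u] neg'[of "-u"] by simp
  next
    case False
    then show ?thesis using ne pos'[of "-u"] neg'[of u] by simp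
  qed
  then show "of_bool (left_germ T x u) - of_bool (left_germ T x (- u)) =
      crossing x u a b + crossing x u b c + crossing x u c a"
    unfolding cr by (elim disjE) (simp_all add: sgn_if)
qed

text \<open>With the vertices excluded, at most one barycentric coordinate of a point of the
  triangle vanishes: the point is interior or on one open edge, and the three edges are cyclic
  images of one case.\<close>

lemma left_germ_triangle_pos:
  assumes D: "orient a b c > 0" and x: "x \<notin> {a, b, c}" and u: "u \<noteq> 0"
    and par: "x \<in> open_segment a b \<Longrightarrow> cross2 u (b - a) = 0"
      "x \<in> open_segment b c \<Longrightarrow> cross2 u (c - b) = 0"
      "x \<in> open_segment c a \<Longrightarrow> cross2 u (a - c) = 0"
  defines "T \<equiv> convex hull {a, b, c}"
  shows "(left_germ (interior T) x u \<or> left_germ (- T) x u) \<and>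
    of_bool (left_germ T x u) - of_bool (left_germ T x (- u)) =
      crossing x u a b + crossing x u b c + crossing x u c a"
proof -
  have imp: "x \<in> open_segment a b \<longrightarrow> cross2 u (b - a) = 0"
      "x \<in> open_segment b c \<longrightarrow> cross2 u (c - b) = 0"
      "x \<in> open_segment c a \<longrightarrow> cross2 u (a - c) = 0"
    using par by blast+
  have Tr: "T = convex hull {b, c, a}" "T = convex hull {c, a, b}"
    unfolding T_def by (simp_all add: insert_commute)
  have Dr: "orient b c a > 0" "orient c a b > 0" using D orient_rotate[of a b c] orient_rotate[of b c a] by auto
  have sub: "open_segment p q \<subseteq> T" if "p \<in> {a, b, c}" "q \<in> {a, b, c}" for p q
    using hull_mono[of "{p, q}" "{a, b, c}" convex] that
    unfolding T_def open_segment_def segment_convex_hull by blast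
  have closedT: "closed T" unfolding T_def by (simp add: compact_convex_hull compact_imp_closed)
  have nonneg: "(orient a b x = 0 \<or> orient a b x > 0) \<and> (orient b c x = 0 \<or> orient b c x > 0) \<and>
      (orient c a x = 0 \<or> orient c a x > 0)" if "x \<in> T"
    using that mem_triangle_iff[OF D, of x] unfolding T_def by auto
  have int: "x \<in> interior T" if "orient a b x > 0" "orient b c x > 0" "orient c a x > 0"
    using mem_interior_triangle that unfolding T_def .
  \<comment> \<open>Two vanishing barycentric coordinates leave only the vertex common to the two
    edges.\<close>
  have vertex: "x = q" if "orient p q z > 0" "orient p q x = 0" "orient q z x = 0" for p q z
    using barycentric[of p q z x] orient_sum[of p q x z] that by simp
  show ?thesis
  proof (cases "x \<in> T")
    case False
    then have l: "left_germ (- T) x v" for v using closedT by (intro left_germ_open) auto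
    then have "\<not> left_germ T x v" for v using left_germ_disjoint[of T x v "-T"] by auto
    moreover have "crossing x u a b = 0" "crossing x u b c = 0" "crossing x u c a = 0"
      using False sub[of a b] sub[of b c] sub[of c a] by (auto simp: crossing_def)
    ultimately show ?thesis using l by simp
  next
    case True
    have "\<not> (orient a b x = 0 \<and> orient b c x = 0)"
    proof
      assume "orient a b x = 0 \<and> orient b c x = 0"
      with vertex[of a b c] D Dr have "x = b" by simp
      with x show False by simp
    qed
    moreover have "\<not> (orient b c x = 0 \<and> orient c a x = 0)"
    proof
      assume "orient b c x = 0 \<and> orient c a x = 0"
      with vertex[of b c a] D Dr have "x = c" by simp
      with x show False by simp
    qed
    moreover have "\<not> (orient c a x = 0 \<and> orient a b x = 0)"
    proof
      assume "orient c a x = 0 \<and> orient a b x = 0"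
      with vertex[of c a b] D Dr have "x = a" by simp
      with x show False by simp
    qed
    ultimately consider "orient a b x > 0" "orient b c x > 0" "orient c a x > 0"
      | "orient a b x = 0" "orient b c x > 0" "orient c a x > 0"
      | "orient b c x = 0" "orient c a x > 0" "orient a b x > 0"
      | "orient c a x = 0" "orient a b x > 0" "orient b c x > 0"
      using nonneg[OF True] by blast
    then show ?thesis
    proof cases
      case 1
      then have l: "left_germ (interior T) x v" for v using int by (intro left_germ_open) auto
      then have "left_germ T x v" for v using interior_subset by (rule left_germ_mono)
      moreover have "crossing x u a b = 0" "crossing x u b c = 0" "crossing x u c a = 0"
        using 1 open_segment_orient[of x a b] open_segment_orient[of x b c] open_segment_orient[of x c a]
        by (auto simp: crossing_def)
      ultimately show ?thesis using l by simp
    next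
      case 2
      note edge = left_germ_triangle_edge[OF D 2 u imp(1), folded T_def]
      from edge(1) show ?thesis by (rule conjI) (rule edge(2))
    next
      case 3
      note edge = left_germ_triangle_edge[OF Dr(1) 3 u imp(2), folded Tr(1)]
      from edge(1) show ?thesis by (rule conjI) (simp only: edge(2) add_ac)
    next
      case 4
      note edge = left_germ_triangle_edge[OF Dr(2) 4 u imp(3), folded Tr(2)]
      from edge(1) show ?thesis by (rule conjI) (simp only: edge(2) add_ac)
    qed
  qed
qed

lemma crossing_swap: "crossing x u b a = - crossing x u a b"
proof -
  have "cross2 u (a - b) = - cross2 u (b - a)" "u \<bullet> (a - b) = - (u \<bullet> (b - a))"
    by (simp_all add: plane_simps algebra_simps)
  then show ?thesis unfolding crossing_def open_segment_commute[of b a] by (simp add: sgn_minus)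
qed

text \<open>The hull is one of the three closed edges, so a point of it that is no vertex lies on an
  open edge, which is parallel to \<open>u\<close>. A step perpendicular to \<open>u\<close> leaves
  the line carrying the hull.\<close>

lemma left_germ_triangle_degenerate:
  assumes D: "orient a b c = 0" and x: "x \<notin> {a, b, c}" and u: "u \<noteq> 0"
    and par: "x \<in> open_segment a b \<Longrightarrow> cross2 u (b - a) = 0"
      "x \<in> open_segment b c \<Longrightarrow> cross2 u (c - b) = 0"
      "x \<in> open_segment c a \<Longrightarrow> cross2 u (a - c) = 0"
  shows "left_germ (- (convex hull {a, b, c})) x u"
proof (cases "x \<in> convex hull {a, b, c}")
  case False
  moreover have "closed (convex hull {a, b, c})" by (simp add: compact_convex_hull compact_imp_closed)
  ultimately show ?thesis by (intro left_germ_open) auto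
next
  case True
  have on_line: "left_germ (- (convex hull {p, q, z})) x u"
    if z: "orient p q z = 0" and op: "x \<in> open_segment p q" and pq: "cross2 u (q - p) = 0" for p q z
  proof -
    have "p \<noteq> q" using op by auto
    then have ne: "u \<bullet> (q - p) \<noteq> 0" using parallel_inner_nonzero u pq by auto
    have line: "orient p q y = 0" if "y \<in> convex hull {p, q, z}" for y
    proof -
      from that obtain r s t where "y = r *\<^sub>R p + s *\<^sub>R q + t *\<^sub>R z" "r + s + t = 1"
        by (auto simp: convex_hull_3)
      then show ?thesis using orient_convex_comb z by simp
    qed
    have x0: "orient p q x = 0" using op by (rule open_segment_orient)
    have "\<forall>\<^sub>F r in at_right 0. (0::real) < r" by (rule eventually_at_right_less)
    then show ?thesis unfolding left_germ_def
    proof eventually_elim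
      case (elim r)
      then have "orient p q (x + r *\<^sub>R rot u) \<noteq> 0" using ne x0 by (simp add: orient_rot)
      with line show ?case by auto
    qed
  qed
  have D': "orient b c a = 0" "orient c a b = 0" using D orient_rotate[of a b c] orient_rotate[of b c a] by auto
  have coll: "collinear {a, b, c}" using D orient_eq_0_collinear by blast
  have "\<exists>p q. {p, q} \<subseteq> {a, b, c} \<and> convex hull {a, b, c} = closed_segment p q \<and> 
    (p, q) \<in> {(a, b), (b, c), (c, a)}"
  proof -
    from coll consider "a \<in> closed_segment b c" | "b \<in> closed_segment c a" | "c \<in> closed_segment a b"
      by (auto simp: collinear_between_cases between_mem_segment)
    then show ?thesis
    proof cases
      case 1
      then have "convex hull {a, b, c} = closed_segment b c"
        by (simp add: segment_convex_hull hull_redundant)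
      then show ?thesis by blast
    next
      case 2
      then have "convex hull (insert b {c, a}) = closed_segment c a"
        by (simp add: segment_convex_hull hull_redundant)
      then have "convex hull {a, b, c} = closed_segment c a" by (simp add: insert_commute)
      then show ?thesis by blast
    next
      case 3
      then have "convex hull (insert c {a, b}) = closed_segment a b"
        by (simp add: segment_convex_hull hull_redundant)
      then have "convex hull {a, b, c} = closed_segment a b" by (simp add: insert_commute)
      then show ?thesis by blast
    qed
  qed
  then consider "x \<in> open_segment a b" | "x \<in> open_segment b c" | "x \<in> open_segment c a"
    using True x by (auto simp: open_segment_def)
  then show ?thesis
  proof cases
    case 1
    then show ?thesis using on_line[OF D 1 par(1)] by simp
  next
    case 2
    then show ?thesis using on_line[OF D'(1) 2 par(2)] by (simp add: insert_commute)
  next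
    case 3
    then show ?thesis using on_line[OF D'(2) 3 par(3)] by (simp add: insert_commute)
  qed
qed

text \<open>The factor \<open>sgn (orient a b c)\<close> unites the orientations: exchanging
  \<open>b\<close> and \<open>c\<close> reverses all three edges, and a degenerate triangle has a
  germ on neither side.\<close>

lemma left_germ_triangle:
  assumes x: "x \<notin> {a, b, c}" and u: "u \<noteq> 0"
    and par: "x \<in> open_segment a b \<Longrightarrow> cross2 u (b - a) = 0"
      "x \<in> open_segment b c \<Longrightarrow> cross2 u (c - b) = 0"
      "x \<in> open_segment c a \<Longrightarrow> cross2 u (a - c) = 0"
  defines "T \<equiv> convex hull {a, b, c}"
  shows "left_germ (interior T) x u \<or> left_germ (- T) x u"
    and "of_bool (left_germ T x u) - of_bool (left_germ T x (- u)) =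
      sgn (orient a b c) * (crossing x u a b + crossing x u b c + crossing x u c a)"
proof -
  have "(left_germ (interior T) x u \<or> left_germ (- T) x u) \<and>
    of_bool (left_germ T x u) - of_bool (left_germ T x (- u)) =
      sgn (orient a b c) * (crossing x u a b + crossing x u b c + crossing x u c a)"
  proof (cases "orient a b c" "0::real" rule: linorder_cases)
    case greater
    then have "(left_germ (interior T) x u \<or> left_germ (- T) x u) \<and>
       of_bool (left_germ T x u) - of_bool (left_germ T x (- u)) =
      crossing x u a b + crossing x u b c + crossing x u c a"
      unfolding T_def by (rule left_germ_triangle_pos) (fact x u par)+
    with greater show ?thesis by simp
  next
    case equal
    have m: "cross2 (-u) v = - cross2 u v" for v by (simp add: cross2_def)
    have "left_germ (- T) x u"
      unfolding T_def by (rule left_germ_triangle_degenerate[OF equal x u par])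
    moreover have "left_germ (- T) x (-u)"
      unfolding T_def by (rule left_germ_triangle_degenerate[OF equal x]) (use u par in \<open>auto simp: m\<close>)
    ultimately have "left_germ (- T) x u" "left_germ (- T) x (-u)" by auto
    moreover from this have "\<not> left_germ T x u" "\<not> left_germ T x (-u)"
      using left_germ_disjoint[of T x _ "-T"] by auto
    ultimately show ?thesis using equal by simp
  next
    case less
    then have "orient a c b > 0" using orient_swap[of a c b] by simp
    moreover have "cross2 u (c - a) = - cross2 u (a - c)" "cross2 u (b - c) = - cross2 u (c - b)"
      "cross2 u (a - b) = - cross2 u (b - a)"
      by (simp_all add: cross2_def algebra_simps)
    then have "x \<in> open_segment a c \<Longrightarrow> cross2 u (c - a) = 0"
      "x \<in> open_segment c b \<Longrightarrow> cross2 u (b - c) = 0"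
      "x \<in> open_segment b a \<Longrightarrow> cross2 u (a - b) = 0"
      using par by (simp_all add: open_segment_commute[of c b] open_segment_commute[of b a] open_segment_commute[of a c])
    moreover have "x \<notin> {a, c, b}" "convex hull {a, c, b} = T"
      using x by (auto simp: T_def insert_commute)
    ultimately have "(left_germ (interior T) x u \<or> left_germ (- T) x u) \<and>
       of_bool (left_germ T x u) - of_bool (left_germ T x (- u)) =
      crossing x u a c + crossing x u c b + crossing x u b a"
      using left_germ_triangle_pos[of a c b x u] u by presburger
    then show ?thesis using less crossing_swap[of x u a c] crossing_swap[of x u b c] crossing_swap[of x u a b] by simp
  qed
  then show "left_germ (interior T) x u \<or> left_germ (- T) x u"
    and "of_bool (left_germ T x u) - of_bool (left_germ T x (- u)) =
      sgn (orient a b c) * (crossing x u a b + crossing x u b c + crossing x u c a)" by auto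
qed

section \<open>Edges of simple polygons\<close>

lemma polygonal_path_ends:
  assumes "xs \<noteq> []"
  shows "pathstart (polygonal_path xs) = hd xs \<and> pathfinish (polygonal_path xs) = last xs"
  using assms by (induction xs rule: polygonal_path.induct) auto

lemma path_image_polygonal_path:
  assumes "length xs \<ge> 2"
  shows "path_image (polygonal_path xs) = (\<Union>i<length xs - 1. closed_segment (xs ! i) (xs ! Suc i))"
  using assms
proof (induction xs rule: polygonal_path.induct)
  case (3 a b)
  then show ?case by (simp add: lessThan_Suc)
next
  case (4 a b c xs)
  then have IH: "path_image (polygonal_path (b # c # xs)) =
      (\<Union>i<Suc (length xs). closed_segment ((b # c # xs) ! i) ((b # c # xs) ! Suc i))" by simp
  have "path_image (polygonal_path (a # b # c # xs)) =
      closed_segment a b \<union> path_image (polygonal_path (b # c # xs))"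
    using polygonal_path_ends[of "b # c # xs"] by (simp add: path_image_join)
  also have "\<dots> = (\<Union>i<Suc (Suc (length xs)). closed_segment ((a # b # c # xs) ! i) ((a # b # c # xs) ! Suc i))"
    unfolding IH lessThan_Suc_eq_insert_0[of "Suc (length xs)"] by (simp add: image_image)
  finally show ?case by simp
qed auto

text \<open>Every vertex is an endpoint of some edge; no edge starts at the last vertex, which is
  treated as the end of the last edge.\<close>

lemma vertex_notin_open_edge:
  assumes "length xs \<ge> 2" "i < length xs - 1" "k < length xs"
    and disj: "\<And>i j. i < length xs - 1 \<Longrightarrow> j < length xs - 1 \<Longrightarrow> i \<noteq> j \<Longrightarrow>
       open_segment (xs ! i) (xs ! Suc i) \<inter> closed_segment (xs ! j) (xs ! Suc j) = {}"
  shows "xs ! k \<notin> open_segment (xs ! i) (xs ! Suc i)"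
proof (cases "k = i \<or> k = Suc i")
  case True
  then show ?thesis by (auto simp: open_segment_def)
next
  case False
  show ?thesis
  proof (cases "k < length xs - 1")
    case True
    then show ?thesis using disj[of i k] assms False by auto
  next
    case k: False
    then have "k = Suc (k - 1)" "k - 1 < length xs - 1" "i \<noteq> k - 1" using assms False by auto
    then show ?thesis using disj[of i "k - 1"] assms by (metis disjoint_iff ends_in_segment(2))
  qed
qed

text \<open>The first edge is split off. By \<open>arc_join_eq\<close> it meets the remaining path
  only in \<open>b\<close>, which makes \<open>a\<close> a new vertex and separates the first edge
  from the others.\<close>

lemma arc_polygonal_path:
  assumes "length xs \<ge> 2" "arc (polygonal_path xs)"
  shows "distinct xs \<and> (\<forall>i<length xs - 1. \<forall>j<length xs - 1. i \<noteq> j \<longrightarrow>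
       open_segment (xs ! i) (xs ! Suc i) \<inter> closed_segment (xs ! j) (xs ! Suc j) = {})"
  using assms
proof (induction xs rule: polygonal_path.induct)
  case (3 a b)
  then have "a \<noteq> b" using arc_distinct_ends[of "linepath a b"] by auto
  then show ?case by simp
next
  case (4 a b c xs)
  define ys where "ys = b # c # xs"
  have len: "length ys = Suc (Suc (length xs))" by (simp add: ys_def)
  have ends: "pathstart (polygonal_path ys) = b"
    using polygonal_path_ends[of ys] by (simp add: ys_def)
  have join: "arc (linepath a b +++ polygonal_path ys)" using 4(3) by (simp add: ys_def)
  have arcs: "arc (linepath a b)" "arc (polygonal_path ys)"
    and int: "closed_segment a b \<inter> path_image (polygonal_path ys) \<subseteq> {b}"
    using join arc_join_eq[of "linepath a b" "polygonal_path ys"] ends by auto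
  have ab: "a \<noteq> b" using arc_distinct_ends[OF arcs(1)] by simp
  have IH: "distinct ys" "\<And>i j. i < length ys - 1 \<Longrightarrow> j < length ys - 1 \<Longrightarrow> i \<noteq> j \<Longrightarrow>
       open_segment (ys ! i) (ys ! Suc i) \<inter> closed_segment (ys ! j) (ys ! Suc j) = {}"
    using 4(1) arcs(2) by (simp_all add: ys_def)
  have pim: "path_image (polygonal_path ys) = (\<Union>i<length ys - 1. closed_segment (ys ! i) (ys ! Suc i))"
    by (rule path_image_polygonal_path) (simp add: len)
  have vert: "z \<in> path_image (polygonal_path ys)" if z: "z \<in> set ys" for z
  proof -
    obtain k where k: "k < length ys" "z = ys ! k" using z by (auto simp: in_set_conv_nth)
    show ?thesis
    proof (cases "k < length ys - 1")
      case True
      then show ?thesis unfolding pim k by blast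
    next
      case False
      then have "k = Suc (length xs)" using k len by simp
      then show ?thesis unfolding pim k len by (auto intro!: bexI[of _ "length xs"])
    qed
  qed
  have anot: "a \<notin> set ys" using vert[of a] int ab by auto
  have b: "b \<notin> open_segment (ys ! i) (ys ! Suc i)" if "i < length ys - 1" for i
    using vertex_notin_open_edge[of ys i 0] IH(2) that len by (simp add: ys_def)
  have seg: "closed_segment (ys ! i) (ys ! Suc i) \<inter> closed_segment a b \<subseteq> {b}" if "i < length ys - 1" for i
    using int that unfolding pim by blast
  have "open_segment ((a # ys) ! i) ((a # ys) ! Suc i) \<inter> closed_segment ((a # ys) ! j) ((a # ys) ! Suc j) = {}"
    if "i < length ys" "j < length ys" "i \<noteq> j" for i j
  proof -
    have ys0: "ys ! 0 = b" by (simp add: ys_def)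
    consider k where "i = 0" "j = Suc k" | k where "i = Suc k" "j = 0" | k l where "i = Suc k" "j = Suc l"
      using \<open>i \<noteq> j\<close> by (metis not0_implies_Suc)
    then show ?thesis
    proof cases
      case 1
      then have k: "k < length ys - 1" using that by simp
      have "open_segment a b \<inter> closed_segment (ys ! k) (ys ! Suc k) = {}"
        using seg[OF k] by (auto simp: open_segment_def)
      then show ?thesis using 1 ys0 by simp
    next
      case 2
      then have k: "k < length ys - 1" using that by simp
      have "open_segment (ys ! k) (ys ! Suc k) \<inter> closed_segment a b = {}"
        using seg[OF k] b[OF k] by (auto simp: open_segment_def)
      then show ?thesis using 2 ys0 by simp
    next
      case 3
      then show ?thesis using IH(2)[of k l] that by simp
    qed
  qed
  then show ?case using anot IH(1) by (simp add: ys_def)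
qed auto

section \<open>Edges of a closed polygon\<close>

definition nxt :: "'a list \<Rightarrow> nat \<Rightarrow> 'a" where
  "nxt vs i = vs ! (Suc i mod length vs)"

lemma nth_append_hd:
  assumes "vs \<noteq> []" "i < length vs"
  shows "(vs @ [hd vs]) ! i = vs ! i" "(vs @ [hd vs]) ! Suc i = nxt vs i"
proof -
  show "(vs @ [hd vs]) ! i = vs ! i" using assms by (simp add: nth_append)
  show "(vs @ [hd vs]) ! Suc i = nxt vs i"
  proof (cases "Suc i = length vs")
    case True
    then show ?thesis using assms by (simp add: nth_append nxt_def hd_conv_nth)
  next
    case False
    then show ?thesis using assms by (simp add: nth_append nxt_def)
  qed
qed

lemma path_image_boundary_path:
  assumes "length vs \<ge> 3"
  shows "path_image (boundary_path vs) = (\<Union>i<length vs. closed_segment (vs ! i) (nxt vs i))"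
proof -
  have "vs \<noteq> []" using assms by auto
  then show ?thesis unfolding boundary_path_def
    using path_image_polygonal_path[of "vs @ [hd vs]"] assms by (simp add: nth_append_hd)
qed

text \<open>The boundary is the first edge followed by an arc from \<open>b\<close> back to
  \<open>a\<close>, and the two meet only in \<open>a\<close> and \<open>b\<close>. The arc is
  covered by \<open>arc_polygonal_path\<close>; both common points are vertices of it, hence outside
  its open edges.\<close>

lemma simple_polygon_edges:
  assumes "simple_polygon vs"
  shows "distinct vs"
    and "\<And>i j. i < length vs \<Longrightarrow> j < length vs \<Longrightarrow> i \<noteq> j \<Longrightarrow>
      open_segment (vs ! i) (nxt vs i) \<inter> closed_segment (vs ! j) (nxt vs j) = {}"
proof -
  obtain a b c r where vs: "vs = a # b # c # r"
    using assms unfolding simple_polygon_def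
    by (metis One_nat_def Suc_1 Suc_le_length_iff numeral_3_eq_3)
  define ys where "ys = b # c # r @ [a]"
  have lys: "length ys = length vs" by (simp add: ys_def vs)
  have ends: "pathstart (polygonal_path ys) = b" "pathfinish (polygonal_path ys) = a"
    using polygonal_path_ends[of ys] by (simp_all add: ys_def)
  have "simple_path (linepath a b +++ polygonal_path ys)"
    using assms by (simp add: simple_polygon_def boundary_path_def vs ys_def)
  then have arcs: "arc (linepath a b)" "arc (polygonal_path ys)"
    and int: "closed_segment a b \<inter> path_image (polygonal_path ys) \<subseteq> {a, b}"
    using simple_path_join_loop_eq[of "polygonal_path ys" "linepath a b"] ends by auto
  have ysd: "distinct ys" "\<And>i j. i < length ys - 1 \<Longrightarrow> j < length ys - 1 \<Longrightarrow> i \<noteq> j \<Longrightarrow>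
       open_segment (ys ! i) (ys ! Suc i) \<inter> closed_segment (ys ! j) (ys ! Suc j) = {}"
    using arc_polygonal_path[OF _ arcs(2)] by (simp_all add: ys_def)
  show "distinct vs" using ysd(1) by (auto simp: ys_def vs)
  have pim: "path_image (polygonal_path ys) = (\<Union>i<length ys - 1. closed_segment (ys ! i) (ys ! Suc i))"
    by (rule path_image_polygonal_path) (simp add: ys_def)
  have ab: "a \<notin> open_segment (ys ! i) (ys ! Suc i)" "b \<notin> open_segment (ys ! i) (ys ! Suc i)"
    if "i < length ys - 1" for i
  proof -
    have "ys ! (length ys - 1) = a" "ys ! 0 = b" by (auto simp: ys_def nth_append)
    moreover have "ys ! k \<notin> open_segment (ys ! i) (ys ! Suc i)" if "k < length ys" for k
      using vertex_notin_open_edge[of ys i k] ysd(2) that \<open>i < length ys - 1\<close> by (simp add: ys_def)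
    moreover have "length ys - 1 < length ys" "0 < length ys" by (simp_all add: ys_def)
    ultimately show "a \<notin> open_segment (ys ! i) (ys ! Suc i)" "b \<notin> open_segment (ys ! i) (ys ! Suc i)"
      by metis+
  qed
  have seg: "closed_segment (ys ! i) (ys ! Suc i) \<inter> closed_segment a b \<subseteq> {a, b}" if "i < length ys - 1" for i
    using int that unfolding pim by blast
  have edge0: "vs ! 0 = a" "nxt vs 0 = b" by (simp_all add: vs nxt_def)
  have edgeS: "vs ! Suc k = ys ! k" "nxt vs (Suc k) = ys ! Suc k" if "Suc k < length vs" for k
  proof -
    have "vs @ [hd vs] = a # ys" by (simp add: vs ys_def)
    then show "vs ! Suc k = ys ! k" "nxt vs (Suc k) = ys ! Suc k"
      using nth_append_hd[of vs "Suc k"] that by (auto simp: vs)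
  qed
  show "open_segment (vs ! i) (nxt vs i) \<inter> closed_segment (vs ! j) (nxt vs j) = {}"
    if "i < length vs" "j < length vs" "i \<noteq> j" for i j
  proof -
    consider k where "i = 0" "j = Suc k" | k where "i = Suc k" "j = 0" | k l where "i = Suc k" "j = Suc l"
      using \<open>i \<noteq> j\<close> by (metis not0_implies_Suc)
    then show ?thesis
    proof cases
      case 1
      then have "k < length ys - 1" using that lys by simp
      from seg[OF this] have "open_segment a b \<inter> closed_segment (ys ! k) (ys ! Suc k) = {}"
        by (auto simp: open_segment_def)
      then show ?thesis using edgeS[of k] edge0 that 1 by simp
    next
      case 2
      then have "k < length ys - 1" using that lys by simp
      from seg[OF this] ab[OF this] have "open_segment (ys ! k) (ys ! Suc k) \<inter> closed_segment a b = {}"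
        by (auto simp: open_segment_def)
      then show ?thesis using edgeS[of k] edge0 that 2 by simp
    next
      case 3
      then show ?thesis using ysd(2)[of k l] edgeS[of k] edgeS[of l] that lys by simp
    qed
  qed
qed

text \<open>The region is closed and the inside of the boundary is open, hence interior, so only
  boundary points are left for the frontier.\<close>

lemma frontier_polygon_region:
  assumes "simple_polygon vs"
  shows "frontier (polygon_region vs) \<subseteq> path_image (boundary_path vs)"
proof -
  define P where "P = path_image (boundary_path vs)"
  have "closed P" using assms unfolding P_def simple_polygon_def
    by (auto intro: closed_path_image simple_path_imp_path)
  then have "closed (P \<union> inside P)"
    by (simp add: union_with_inside closed_Compl open_outside)
  moreover have "inside P \<subseteq> interior (P \<union> inside P)"
    using \<open>closed P\<close> by (intro interior_maximal open_inside) auto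
  ultimately show ?thesis
    unfolding frontier_def polygon_region_def P_def[symmetric] using closure_closed by blast
qed

section \<open>Dissections of regions with polygonal frontier\<close>

lemma left_germ_not_frontier:
  assumes "x \<notin> frontier B"
  shows "left_germ B x u \<longleftrightarrow> x \<in> B"
proof (cases "x \<in> B")
  case True
  then have "x \<in> interior B" using assms closure_subset by (auto simp: frontier_def)
  then have "left_germ (interior B) x u" by (intro left_germ_open) auto
  then show ?thesis using True left_germ_mono interior_subset by blast
next
  case False
  then have "x \<in> - closure B" using assms interior_subset by (auto simp: frontier_def)
  then have "left_germ (- closure B) x u" by (intro left_germ_open) auto
  then show ?thesis using False left_germ_disjoint[of B x u "- closure B"] closure_subset[of B] by blast
qed

text \<open>What the counting argument takes from a simple polygon: edges that meet only in
  endpoints and carry the frontier. Which sides of an edge belong to \<open>B\<close> is read off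
  from germs.\<close>

locale polygonal_frontier =
  fixes n :: nat and v w :: "nat \<Rightarrow> real^2" and B :: "(real^2) set"
  assumes frontier_edges: "frontier B \<subseteq> (\<Union>i<n. closed_segment (v i) (w i))"
    and edge_nondeg: "\<And>i. i < n \<Longrightarrow> v i \<noteq> w i"
    and edges_disjoint: "\<And>i j. i < n \<Longrightarrow> j < n \<Longrightarrow> i \<noteq> j \<Longrightarrow>
      open_segment (v i) (w i) \<inter> closed_segment (v j) (w j) = {}"
begin

text \<open>A small disc about \<open>x\<close> meets no other edge, so its open half to the left of
  \<open>d\<close> avoids the frontier. Being connected, this half lies inside \<open>B\<close> or
  outside.\<close>

lemma left_germ_locally_const:
  assumes i: "i < n" and x: "x \<in> open_segment (v i) (w i)"
    and d: "d \<noteq> 0" "cross2 d (w i - v i) = 0"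
  obtains e where "e > 0"
    "\<And>z. z \<in> ball x e \<Longrightarrow> z \<in> open_segment (v i) (w i) \<Longrightarrow> left_germ B z d \<longleftrightarrow> left_germ B x d"
proof -
  define C where "C = (\<Union>j\<in>{..<n} - {i}. closed_segment (v j) (w j))"
  have "closed C" unfolding C_def by (intro closed_UN) auto
  moreover have "x \<notin> C" using edges_disjoint[OF i] x by (auto simp: C_def)
  ultimately obtain e where e: "e > 0" "ball x e \<inter> C = {}"
    by (metis Compl_iff closed_def disjoint_eq_subset_Compl openE)
  define H where "H = ball x e \<inter> {y. rot d \<bullet> y > rot d \<bullet> x}"
  have seg: "rot d \<bullet> y = rot d \<bullet> x" if "y \<in> closed_segment (v i) (w i)" for y
  proof -
    obtain k where k: "w i - v i = k *\<^sub>R d" using cross2_eq_0 d by blast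
    have "rot d \<bullet> (w i - v i) = 0" unfolding k by (simp add: plane_simps)
    then have eq: "rot d \<bullet> w i = rot d \<bullet> v i" by (simp add: inner_diff_right)
    have "rot d \<bullet> z = rot d \<bullet> v i" if z: "z \<in> closed_segment (v i) (w i)" for z
    proof -
      obtain t where "z = (1 - t) *\<^sub>R v i + t *\<^sub>R w i" using z by (auto simp: in_segment)
      then show ?thesis by (simp add: inner_add_right eq left_diff_distrib)
    qed
    moreover have "x \<in> closed_segment (v i) (w i)" using x by (simp add: open_segment_def)
    ultimately show ?thesis using that by metis
  qed
  have "H \<inter> frontier B = {}"
  proof -
    have "y \<notin> frontier B" if "y \<in> H" for y
    proof
      assume "y \<in> frontier B"
      then obtain j where j: "j < n" "y \<in> closed_segment (v j) (w j)" using frontier_edges by auto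
      then show False using seg[of y] that e by (cases "j = i") (auto simp: H_def C_def)
    qed
    then show ?thesis by auto
  qed
  moreover have "connected H" unfolding H_def
    by (intro convex_connected convex_Int convex_ball convex_halfspace_gt)
  ultimately have H: "H \<inter> B = {} \<or> H - B = {}" using connected_Int_frontier by blast
  have rotd: "rot d \<bullet> rot d > 0" using d(1) by (auto simp: plane_simps sum_squares_gt_zero_iff)
  have germ: "left_germ B z d \<longleftrightarrow> H \<subseteq> B" if z: "z \<in> ball x e" "z \<in> closed_segment (v i) (w i)" for z
  proof -
    have "left_germ (ball x e) z d" using z by (intro left_germ_open) auto
    then have "left_germ H z d"
      unfolding left_germ_def using eventually_at_right_less[of "0::real"]
    proof eventually_elim
      case (elim r)
      then show ?case using rotd seg[OF z(2)] by (simp add: H_def inner_add_right)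
    qed
    then show ?thesis using H left_germ_mono[of H z d B] left_germ_disjoint[of H z d B] by blast
  qed
  show thesis
  proof
    show "e > 0" by fact
    show "left_germ B z d \<longleftrightarrow> left_germ B x d" if "z \<in> ball x e" "z \<in> open_segment (v i) (w i)" for z
      using germ[of z] germ[of x] that x \<open>e > 0\<close> by (simp add: open_segment_def)
  qed
qed

lemma left_germ_const_on_edge:
  assumes i: "i < n" and xy: "x \<in> open_segment (v i) (w i)" "y \<in> open_segment (v i) (w i)"
    and d: "d \<noteq> 0" "cross2 d (w i - v i) = 0"
  shows "left_germ B x d \<longleftrightarrow> left_germ B y d"
proof (rule connected_local_const[OF _ xy])
  show "connected (open_segment (v i) (w i))" by (intro convex_connected convex_open_segment)
  show "\<forall>x\<in>open_segment (v i) (w i). \<forall>\<^sub>F z in at x within open_segment (v i) (w i).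
      left_germ B x d = left_germ B z d"
  proof
    fix x assume x: "x \<in> open_segment (v i) (w i)"
    obtain e where "e > 0" and e: "\<And>z. z \<in> ball x e \<Longrightarrow> z \<in> open_segment (v i) (w i) \<Longrightarrow> left_germ B z d \<longleftrightarrow> left_germ B x d"
      using left_germ_locally_const[OF i x d] by blast
    then show "\<forall>\<^sub>F z in at x within open_segment (v i) (w i). left_germ B x d = left_germ B z d"
      unfolding eventually_at by (auto simp: dist_commute intro!: exI[of _ e])
  qed
qed

text \<open>Membership just left of the edge minus membership just right of it. The midpoint serves
  as a sample, representative by \<open>left_germ_const_on_edge\<close>.\<close>

definition edge_sign :: "nat \<Rightarrow> real" where
  "edge_sign i = of_bool (left_germ B (midpoint (v i) (w i)) (w i - v i))
    - of_bool (left_germ B (midpoint (v i) (w i)) (v i - w i))"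

lemma edge_sign_cases: "edge_sign i \<in> {-1, 0, 1}"
  by (auto simp: edge_sign_def of_bool_def)

text \<open>Off the edges nothing changes across \<open>x\<close>. Otherwise \<open>x\<close> lies
  on exactly one open edge, and the germs there agree with those at its midpoint.\<close>

lemma region_jump:
  assumes x: "\<And>i. i < n \<Longrightarrow> x \<noteq> v i \<and> x \<noteq> w i" and u: "u \<noteq> 0"
    and par: "\<And>i. i < n \<Longrightarrow> x \<in> open_segment (v i) (w i) \<Longrightarrow> cross2 u (w i - v i) = 0"
  shows "of_bool (left_germ B x u) - of_bool (left_germ B x (- u)) =
    (\<Sum>i<n. edge_sign i * crossing x u (v i) (w i))"
proof (cases "\<exists>i<n. x \<in> closed_segment (v i) (w i)")
  case False
  then have "x \<notin> frontier B" using frontier_edges by auto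
  moreover have "crossing x u (v i) (w i) = 0" if "i < n" for i
    using False that by (auto simp: crossing_def open_segment_def)
  ultimately show ?thesis by (simp add: left_germ_not_frontier)
next
  case True
  then obtain i where i: "i < n" "x \<in> closed_segment (v i) (w i)" by auto
  then have op: "x \<in> open_segment (v i) (w i)" using x by (auto simp: open_segment_def)
  have "crossing x u (v j) (w j) = 0" if "j < n" "j \<noteq> i" for j
    using edges_disjoint[of j i] i that by (auto simp: crossing_def)
  then have sum: "(\<Sum>i<n. edge_sign i * crossing x u (v i) (w i)) = edge_sign i * crossing x u (v i) (w i)"
    using i by (subst sum.remove[of _ i]) (auto intro!: sum.neutral)
  have par: "cross2 u (w i - v i) = 0" using par i op by blast
  then have parm: "cross2 (- u) (w i - v i) = 0" by (simp add: cross2_def)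
  obtain k where k: "w i - v i = k *\<^sub>R u" using cross2_eq_0[OF u par] .
  then have km: "v i - w i = k *\<^sub>R (- u)" by (simp add: algebra_simps)
  have "k \<noteq> 0" using k edge_nondeg[OF i(1)] by auto
  have mid: "midpoint (v i) (w i) \<in> open_segment (v i) (w i)"
    using edge_nondeg[OF i(1)] by simp
  have cr: "crossing x u (v i) (w i) = sgn k"
    using op par u by (simp add: crossing_def k sgn_mult)
  have const: "left_germ B (midpoint (v i) (w i)) u \<longleftrightarrow> left_germ B x u"
    "left_germ B (midpoint (v i) (w i)) (- u) \<longleftrightarrow> left_germ B x (- u)"
    using left_germ_const_on_edge[OF i(1) mid op] u par parm by auto
  have es: "edge_sign i = of_bool (left_germ B (midpoint (v i) (w i)) (k *\<^sub>R u))
      - of_bool (left_germ B (midpoint (v i) (w i)) (k *\<^sub>R (- u)))"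
    unfolding edge_sign_def k km ..
  show ?thesis
  proof (cases "k > 0")
    case True
    then show ?thesis unfolding sum cr es
      by (simp only: left_germ_scaleR const) simp
  next
    case False
    \<comment> \<open>Against the direction of the edge, left and right are exchanged, which matches
      the sign of \<open>crossing\<close>.\<close>
    then have "-k > 0" using \<open>k \<noteq> 0\<close> by simp
    moreover have "k *\<^sub>R u = (-k) *\<^sub>R (-u)" "k *\<^sub>R (-u) = (-k) *\<^sub>R u" by simp_all
    ultimately show ?thesis using False \<open>k \<noteq> 0\<close> unfolding sum cr es
      by (simp only: left_germ_scaleR const) simp
  qed
qed

end

section \<open>Chains seen from generic points\<close>

lemma finite_line_Int:
  assumes "cross2 (b - a) (d - c) \<noteq> 0"
  shows "finite {x. orient a b x = 0 \<and> orient c d x = 0}"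
proof -
  have "x = y" if "orient a b x = 0" "orient c d x = 0" "orient a b y = 0" "orient c d y = 0" for x y
  proof (rule ccontr)
    assume "x \<noteq> y"
    have 0: "cross2 (y - x) (b - a) = 0" "cross2 (y - x) (d - c) = 0"
      using that by (simp_all add: orient_def cross2_def algebra_simps)
    have "y - x \<noteq> 0" using \<open>x \<noteq> y\<close> by simp
    then obtain k where k: "b - a = k *\<^sub>R (y - x)" using cross2_eq_0[OF _ 0(1)] by blast
    show False using 0(2) assms unfolding k by (simp add: cross2_scaleR)
  qed
  then have "{x. orient a b x = 0 \<and> orient c d x = 0} \<subseteq> {SOME x. orient a b x = 0 \<and> orient c d x = 0}"
    by (auto intro: someI2)
  then show ?thesis using finite_subset by blast
qed

text \<open>It suffices to test points that are no endpoints, with all segments through them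
  parallel to \<open>u\<close>. If no segment through \<open>x\<close> runs along \<open>u\<close>,
  the crossing sum is trivially zero; if one does, only finitely many points fail the test.\<close>

theorem chain_vanishes_generic:
  fixes I :: "'i set" and a b :: "'i \<Rightarrow> real^2" and n :: "'i \<Rightarrow> real"
  assumes I: "finite I"
    and generic: "\<And>x u. u \<noteq> 0 \<Longrightarrow> (\<And>i. i \<in> I \<Longrightarrow> x \<noteq> a i \<and> x \<noteq> b i) \<Longrightarrow>
      (\<And>i. i \<in> I \<Longrightarrow> x \<in> open_segment (a i) (b i) \<Longrightarrow> cross2 u (b i - a i) = 0) \<Longrightarrow>
      (\<Sum>i\<in>I. n i * crossing x u (a i) (b i)) = 0"
    and \<sigma>: "chain_additive \<sigma>"
  shows "(\<Sum>i\<in>I. n i * \<sigma> (a i) (b i)) = 0"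
proof -
  \<comment> \<open>Degenerate segments are dropped; they have neither crossings nor a value under
    \<open>\<sigma>\<close>.\<close>
  define J where "J = {i\<in>I. a i \<noteq> b i}"
  \<comment> \<open>The exceptional points: endpoints, and intersections of two nonparallel lines
    that carry segments.\<close>
  define Z where "Z = a ` I \<union> b ` I \<union>
    (\<Union>(i, j)\<in>{(i, j)\<in>I \<times> I. cross2 (b i - a i) (b j - a j) \<noteq> 0}. {x. orient (a i) (b i) x = 0 \<and> orient (a j) (b j) x = 0})"
  have J: "finite J" "J \<subseteq> I" using I by (auto simp: J_def)
  have "finite {(i, j)\<in>I \<times> I. cross2 (b i - a i) (b j - a j) \<noteq> 0}"
    by (rule finite_subset[of _ "I \<times> I"]) (use I in auto)
  then have Z: "finite Z" unfolding Z_def using I by (auto intro!: finite_line_Int)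
  interpret vanishing_crossings J a b n Z
  proof
    fix x u :: "real^2" assume x: "x \<notin> Z" and u: "u \<noteq> 0"
    have "(\<Sum>i\<in>I. n i * crossing x u (a i) (b i)) = 0"
    proof (cases "\<exists>i\<in>I. x \<in> open_segment (a i) (b i) \<and> cross2 u (b i - a i) = 0")
      case True
      then obtain i where i: "i \<in> I" "x \<in> open_segment (a i) (b i)" "cross2 u (b i - a i) = 0" by auto
      obtain k where k: "b i - a i = k *\<^sub>R u" using cross2_eq_0[OF u i(3)] .
      have k0: "k \<noteq> 0" using i(2) k by auto
      show ?thesis
      proof (rule generic[OF u])
        show "x \<noteq> a j \<and> x \<noteq> b j" if "j \<in> I" for j using x that by (auto simp: Z_def)
        show "cross2 u (b j - a j) = 0" if "j \<in> I" "x \<in> open_segment (a j) (b j)" for j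
        proof (rule ccontr)
          assume "cross2 u (b j - a j) \<noteq> 0"
          then have "cross2 (b i - a i) (b j - a j) \<noteq> 0" using k0 by (simp add: k cross2_scaleR)
          then have "x \<in> Z" unfolding Z_def
            using i that open_segment_orient[of x "a i" "b i"] open_segment_orient[of x "a j" "b j"] by blast
          with x show False by simp
        qed
      qed
    next
      case False
      then show ?thesis by (auto simp: crossing_def intro!: sum.neutral)
    qed
    also have "(\<Sum>i\<in>I. n i * crossing x u (a i) (b i)) = (\<Sum>i\<in>J. n i * crossing x u (a i) (b i))"
      using I J by (intro sum.mono_neutral_right) (auto simp: J_def crossing_def)
    finally show "(\<Sum>i\<in>J. n i * crossing x u (a i) (b i)) = 0" .
  qed (use J Z in \<open>auto simp: J_def\<close>)
  have "(\<Sum>i\<in>I. n i * \<sigma> (a i) (b i)) = (\<Sum>i\<in>J. n i * \<sigma> (a i) (b i))"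
    using I J chain_additive_refl[OF \<sigma>] by (intro sum.mono_neutral_right) (auto simp: J_def)
  then show ?thesis using chain_vanishes[OF \<sigma>] by simp
qed

locale dissection = polygonal_frontier n v w B for n v w B +
  fixes m :: nat and p q r :: "nat \<Rightarrow> real^2"
  assumes cover: "B = (\<Union>j<m. convex hull {p j, q j, r j})"
    and interiors: "\<And>j k. j < m \<Longrightarrow> k < m \<Longrightarrow> j \<noteq> k \<Longrightarrow>
      interior (convex hull {p j, q j, r j}) \<inter> interior (convex hull {p k, q k, r k}) = {}"
begin

abbreviation (input) "tri j \<equiv> convex hull {p j, q j, r j}"

text \<open>By the dichotomy, a triangle with a left germ has it in its interior, and interiors are
  disjoint, so at most one triangle counts. If none does, the finitely many complements share the
  germ.\<close>

lemma sum_left_germs: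
  assumes dich: "\<And>j. j < m \<Longrightarrow> left_germ (interior (tri j)) x u \<or> left_germ (- tri j) x u"
  shows "(\<Sum>j<m. of_bool (left_germ (tri j) x u) :: real) = of_bool (left_germ B x u)"
proof (cases "\<exists>j<m. left_germ (tri j) x u")
  case True
  then obtain j where j: "j < m" "left_germ (tri j) x u" by auto
  have int: "left_germ (interior (tri k)) x u" if "k < m" "left_germ (tri k) x u" for k
    using dich[OF that(1)] left_germ_disjoint[OF that(2)] by blast
  have "\<not> left_germ (tri k) x u" if "k < m" "k \<noteq> j" for k
    using int[OF j] int[OF that(1)] interiors[OF j(1) that(1)] that(2) left_germ_disjoint by blast
  then have "(\<Sum>j<m. of_bool (left_germ (tri j) x u) :: real) = 1"
    using j by (subst sum.remove[of _ j]) (auto intro!: sum.neutral)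
  moreover have "left_germ B x u" using j by (auto intro: left_germ_mono simp: cover)
  ultimately show ?thesis by simp
next
  case False
  then have "\<forall>j\<in>{..<m}. left_germ (- tri j) x u"
    using dich left_germ_mono[OF _ interior_subset] by blast
  then have "left_germ (- B) x u" unfolding left_germ_def cover
    by (simp add: eventually_ball_finite_distrib)
  then have "\<not> left_germ B x u" using left_germ_disjoint by blast
  with False show ?thesis by simp
qed

text \<open>At a generic point, the signed triangle boundaries and the weighted edges of the region
  both count the jump of \<open>B\<close> from the right of \<open>u\<close> to its left. Their
  difference is a chain to which \<open>chain_vanishes_generic\<close> applies.\<close>

lemma dissection_chain:
  assumes "chain_additive \<sigma>"
  shows "(\<Sum>j<m. sgn (orient (p j) (q j) (r j)) * (\<sigma> (p j) (q j) + \<sigma> (q j) (r j) + \<sigma> (r j) (p j)))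
    = (\<Sum>i<n. edge_sign i * \<sigma> (v i) (w i))"
proof -
  \<comment> \<open>One index set for the three edges of each triangle and the edges of the region,
    the latter with the opposite weight.\<close>
  define I where "I = {..<m} <+> {..<m} <+> {..<m} <+> {..<n}"
  define A where "A = case_sum p (case_sum q (case_sum r v))"
  define Z where "Z = case_sum q (case_sum r (case_sum p w))"
  define c where "c j = sgn (orient (p j) (q j) (r j))" for j
  define N where "N = case_sum c (case_sum c (case_sum c (\<lambda>i. - edge_sign i)))"
  have sum_I: "(\<Sum>i\<in>I. N i * f (A i) (Z i)) =
    (\<Sum>j<m. c j * (f (p j) (q j) + f (q j) (r j) + f (r j) (p j))) - (\<Sum>i<n. edge_sign i * f (v i) (w i))" for f
    unfolding I_def by (simp add: sum.Plus A_def Z_def N_def sum_negf sum.distrib distrib_left)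
  have "(\<Sum>i\<in>I. N i * \<sigma> (A i) (Z i)) = 0"
  proof (rule chain_vanishes_generic[OF _ _ assms])
    show "finite I" by (simp add: I_def)
    fix x u :: "real^2"
    assume u: "u \<noteq> 0" and ends: "\<And>i. i \<in> I \<Longrightarrow> x \<noteq> A i \<and> x \<noteq> Z i"
      and par: "\<And>i. i \<in> I \<Longrightarrow> x \<in> open_segment (A i) (Z i) \<Longrightarrow> cross2 u (Z i - A i) = 0"
    have mem: "j < m \<Longrightarrow> Inl j \<in> I" "j < m \<Longrightarrow> Inr (Inl j) \<in> I" "j < m \<Longrightarrow> Inr (Inr (Inl j)) \<in> I"
      "j < n \<Longrightarrow> Inr (Inr (Inr j)) \<in> I" for j
      by (auto simp: I_def)
    have par': "j < m \<Longrightarrow> x \<in> open_segment (p j) (q j) \<Longrightarrow> cross2 u (q j - p j) = 0"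
      "j < m \<Longrightarrow> x \<in> open_segment (q j) (r j) \<Longrightarrow> cross2 u (r j - q j) = 0"
      "j < m \<Longrightarrow> x \<in> open_segment (r j) (p j) \<Longrightarrow> cross2 u (p j - r j) = 0"
      "j < n \<Longrightarrow> x \<in> open_segment (v j) (w j) \<Longrightarrow> cross2 u (w j - v j) = 0" for j
      using par[OF mem(1), of j] par[OF mem(2), of j] par[OF mem(3), of j] par[OF mem(4), of j]
      by (simp_all add: A_def Z_def)
    have ends': "j < m \<Longrightarrow> x \<notin> {p j, q j, r j}" "j < n \<Longrightarrow> x \<noteq> v j \<and> x \<noteq> w j" for j
      using ends[OF mem(1), of j] ends[OF mem(2), of j] ends[OF mem(4), of j]
      by (simp_all add: A_def Z_def)
    have minus: "cross2 (- u) y = - cross2 u y" for y by (simp add: cross2_def)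
    have dich: "left_germ (interior (tri j)) x u \<or> left_germ (- tri j) x u"
      "left_germ (interior (tri j)) x (- u) \<or> left_germ (- tri j) x (- u)"
      "of_bool (left_germ (tri j) x u) - of_bool (left_germ (tri j) x (- u)) =
        c j * (crossing x u (p j) (q j) + crossing x u (q j) (r j) + crossing x u (r j) (p j))" if j: "j < m" for j
      unfolding c_def
      by (rule left_germ_triangle[OF ends'(1)[OF j]]; use u par'(1-3)[OF j] in \<open>simp add: minus\<close>)+
    have "(\<Sum>j<m. c j * (crossing x u (p j) (q j) + crossing x u (q j) (r j) + crossing x u (r j) (p j))) =
        (\<Sum>j<m. of_bool (left_germ (tri j) x u)) - (\<Sum>j<m. of_bool (left_germ (tri j) x (- u)))"
      unfolding sum_subtractf[symmetric] by (rule sum.cong) (simp_all add: dich(3))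
    also have "\<dots> = of_bool (left_germ B x u) - of_bool (left_germ B x (- u))"
      by (simp only: sum_left_germs dich(1,2))
    also have "\<dots> = (\<Sum>i<n. edge_sign i * crossing x u (v i) (w i))"
      using ends' u par' by (intro region_jump) auto
    finally show "(\<Sum>i\<in>I. N i * crossing x u (A i) (Z i)) = 0" unfolding sum_I by simp
  qed
  then show ?thesis unfolding sum_I c_def by simp
qed

end

section \<open>A dyadic valuation ring of the reals and Monsky's colouring\<close>

definition subring :: "real set \<Rightarrow> bool" where
  "subring R \<longleftrightarrow> 1 \<in> R \<and> (\<forall>x\<in>R. \<forall>y\<in>R. x - y \<in> R \<and> x * y \<in> R)"

lemma subringD:
  assumes "subring R"
  shows "1 \<in> R" "x \<in> R \<Longrightarrow> y \<in> R \<Longrightarrow> x - y \<in> R" "x \<in> R \<Longrightarrow> y \<in> R \<Longrightarrow> x * y \<in> R"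
    "0 \<in> R" "x \<in> R \<Longrightarrow> - x \<in> R" "x \<in> R \<Longrightarrow> y \<in> R \<Longrightarrow> x + y \<in> R"
proof -
  show 1: "1 \<in> R" and d: "\<And>x y. x \<in> R \<Longrightarrow> y \<in> R \<Longrightarrow> x - y \<in> R"
    and "x \<in> R \<Longrightarrow> y \<in> R \<Longrightarrow> x * y \<in> R"
    using assms by (auto simp: subring_def)
  show 0: "0 \<in> R" using d[OF 1 1] by simp
  show m: "- x \<in> R" if "x \<in> R" for x using d[OF 0 that] by simp
  show "x \<in> R \<Longrightarrow> y \<in> R \<Longrightarrow> x + y \<in> R" using d[OF _ m[of y], of x] by simp
qed

lemma subring_sum:
  assumes "subring R" "\<And>i. i \<in> A \<Longrightarrow> f i \<in> R"
  shows "sum f A \<in> R"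
  using assms(2) by (induction A rule: infinite_finite_induct) (auto intro: subringD[OF assms(1)])

definition polys_over :: "real set \<Rightarrow> real poly set" where
  "polys_over R = {p. \<forall>i. coeff p i \<in> R}"

lemma polys_over_mult:
  assumes "subring R" "p \<in> polys_over R" "q \<in> polys_over R"
  shows "p * q \<in> polys_over R"
  using assms(2,3) unfolding polys_over_def
  by (auto simp: coeff_mult intro!: subring_sum[OF assms(1)] subringD(3)[OF assms(1)])

definition adjoin :: "real set \<Rightarrow> real \<Rightarrow> real set" where
  "adjoin R x = (\<lambda>p. poly p x) ` polys_over R"

lemma subring_adjoin:
  assumes R: "subring R"
  shows "subring (adjoin R x)" "R \<subseteq> adjoin R x" "x \<in> adjoin R x"
proof -
  have const: "[:a:] \<in> polys_over R" if "a \<in> R" for a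
    using that subringD(4)[OF R] by (auto simp: polys_over_def coeff_pCons split: nat.split)
  show sub: "R \<subseteq> adjoin R x"
  proof
    fix a assume "a \<in> R"
    from const[OF this] show "a \<in> adjoin R x" unfolding adjoin_def by (rule rev_image_eqI) simp
  qed
  have "[:0, 1:] \<in> polys_over R"
    using subringD(1,4)[OF R] by (auto simp: polys_over_def coeff_pCons split: nat.split)
  then show "x \<in> adjoin R x" unfolding adjoin_def by (rule rev_image_eqI) simp
  have "poly p x - poly q x \<in> adjoin R x" "poly p x * poly q x \<in> adjoin R x"
    if "p \<in> polys_over R" "q \<in> polys_over R" for p q
  proof -
    have "p - q \<in> polys_over R" using that subringD(2)[OF R] by (simp add: polys_over_def)
    then show "poly p x - poly q x \<in> adjoin R x"
      unfolding adjoin_def by (rule rev_image_eqI) simp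
    show "poly p x * poly q x \<in> adjoin R x"
      unfolding adjoin_def using polys_over_mult[OF R that] by (rule rev_image_eqI) simp
  qed
  then show "subring (adjoin R x)"
    using sub subringD(1)[OF R] by (auto simp: subring_def adjoin_def)
qed

lemma adjoin_sum_powers:
  assumes "subring R" "z \<in> adjoin R x"
  obtains n c where "\<And>i. c i \<in> R" "z = (\<Sum>i<Suc n. c i * x ^ i)"
proof -
  obtain p where "p \<in> polys_over R" "z = poly p x" using assms(2) by (auto simp: adjoin_def)
  then show thesis using that[of "coeff p" "degree p"]
    by (auto simp: polys_over_def poly_altdef lessThan_Suc_atMost)
qed

text \<open>Zorn's lemma: the integers omit 1/2, and so does the union of a chain. Maximality makes
  the result a valuation ring in which 2 is not a unit.\<close>

lemma exists_maximal_subring: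
  "\<exists>R. subring R \<and> 1 / 2 \<notin> R \<and> (\<forall>S. subring S \<longrightarrow> R \<subseteq> S \<longrightarrow> 1 / 2 \<notin> S \<longrightarrow> S = R)"
proof -
  define \<A> where "\<A> = {S. subring S \<and> 1 / 2 \<notin> S}"
  have "\<exists>M\<in>\<A>. \<forall>X\<in>\<A>. M \<subseteq> X \<longrightarrow> X = M"
  proof (rule subset_Zorn_nonempty)
    have "1 / 2 \<notin> (\<int> :: real set)"
    proof
      assume "1 / 2 \<in> (\<int> :: real set)"
      then obtain k where "1 / 2 = real_of_int k" by (rule Ints_cases)
      then have "real_of_int (2 * k) = 1" by simp
      then have "2 * k = 1" by (simp only: of_int_eq_1_iff)
      then show False by presburger
    qed
    then have "\<int> \<in> \<A>" by (auto simp: \<A>_def subring_def)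
    then show "\<A> \<noteq> {}" by auto
  next
    fix \<C> assume C: "\<C> \<noteq> {}" "subset.chain \<A> \<C>"
    have sub: "\<C> \<subseteq> \<A>" and tot: "\<And>X Y. X \<in> \<C> \<Longrightarrow> Y \<in> \<C> \<Longrightarrow> X \<subseteq> Y \<or> Y \<subseteq> X"
      using C(2) unfolding subset_chain_def by auto
    have "x - y \<in> \<Union>\<C> \<and> x * y \<in> \<Union>\<C>" if xy: "x \<in> \<Union>\<C>" "y \<in> \<Union>\<C>" for x y
    proof -
      obtain X Y where XY: "X \<in> \<C>" "x \<in> X" "Y \<in> \<C>" "y \<in> Y" using xy by auto
      then obtain W where "W \<in> \<C>" "x \<in> W" "y \<in> W" using tot[OF XY(1) XY(3)] by blast
      then show ?thesis using sub by (auto simp: \<A>_def subring_def)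
    qed
    moreover have "1 \<in> \<Union>\<C>" using C(1) sub by (auto simp: \<A>_def subring_def)
    moreover have "1 / 2 \<notin> \<Union>\<C>" using sub by (auto simp: \<A>_def)
    ultimately show "\<Union>\<C> \<in> \<A>" by (auto simp: \<A>_def subring_def)
  qed
  then show ?thesis by (auto simp: \<A>_def)
qed

section \<open>The maximal subring as a valuation ring\<close>

locale maximal_subring =
  fixes R :: "real set"
  assumes subring: "subring R" and half: "1 / 2 \<notin> R"
    and maximal: "\<And>S. subring S \<Longrightarrow> R \<subseteq> S \<Longrightarrow> 1 / 2 \<notin> S \<Longrightarrow> S = R"
begin

lemmas R_closed = subringD[OF subring]

lemma power_mem: "x \<in> R \<Longrightarrow> x ^ n \<in> R"
  by (induction n) (auto intro: R_closed)

lemma two_mem: "2 \<in> R"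
  using R_closed(6)[OF R_closed(1) R_closed(1)] by simp

lemma half_mem_adjoin: "x \<notin> R \<Longrightarrow> 1 / 2 \<in> adjoin R x"
  using maximal[of "adjoin R x"] subring_adjoin[OF subring, of x] by auto

text \<open>Otherwise 1/2 would be a polynomial in the inverse of \<open>s\<close>, and clearing
  denominators would put \<open>s ^ n / 2\<close> into \<open>R\<close>. As \<open>s ^ n\<close> is
  again 1 minus twice an element of \<open>R\<close>, this would put 1/2 into
  \<open>R\<close>.\<close>

lemma inverse_one_minus_even:
  assumes b: "b \<in> R"
  shows "inverse (1 - 2 * b) \<in> R"
proof (rule ccontr)
  define s where "s = 1 - 2 * b"
  assume "inverse (1 - 2 * b) \<notin> R"
  then have "1 / 2 \<in> adjoin R (inverse s)" using half_mem_adjoin by (simp add: s_def)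
  then obtain n c where c: "\<And>i. c i \<in> R" and eq: "1 / 2 = (\<Sum>i<Suc n. c i * inverse s ^ i)"
    using adjoin_sum_powers[OF subring] by metis
  have "s \<noteq> 0"
  proof
    assume "s = 0"
    then have "b = 1 / 2" by (simp add: s_def)
    with half b show False by metis
  qed
  have s: "s \<in> R" unfolding s_def by (intro R_closed two_mem b)
  have "s ^ n / 2 = (\<Sum>i<Suc n. s ^ n * (c i * inverse s ^ i))"
    using eq by (metis sum_distrib_left times_divide_eq_right mult.right_neutral)
  also have "\<dots> = (\<Sum>i<Suc n. c i * s ^ (n - i))"
    using \<open>s \<noteq> 0\<close> by (intro sum.cong) (auto simp: power_diff field_simps)
  also have "\<dots> \<in> R" using c power_mem[OF s] by (intro subring_sum[OF subring] R_closed) auto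
  finally have "s ^ n / 2 \<in> R" .
  moreover have "\<exists>e\<in>R. s ^ n = 1 - 2 * e"
  proof (induction n)
    case 0
    then show ?case using R_closed by (intro bexI[of _ 0]) auto
  next
    case (Suc n)
    then obtain e where e: "e \<in> R" "s ^ n = 1 - 2 * e" by auto
    have "s ^ Suc n = 1 - 2 * (b + e - 2 * (b * e))"
      unfolding power_Suc e(2) by (simp add: s_def algebra_simps)
    moreover have "b + e - 2 * (b * e) \<in> R" by (intro R_closed two_mem b e)
    ultimately show ?case by blast
  qed
  then obtain e where e: "e \<in> R" "s ^ n = 1 - 2 * e" by auto
  ultimately have "(1 - 2 * e) / 2 + e \<in> R" by (intro R_closed) auto
  moreover have "(1 - 2 * e) / 2 + e = 1 / 2" by (simp add: field_simps)
  ultimately show False using half by metis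
qed

text \<open>A relation expressing \<open>1/2\<close> through powers of \<open>x\<close> becomes shorter
  when its top power is eliminated by means of such a relation for the inverse of \<open>x\<close>.\<close>

lemma shorten_relation:
  assumes x: "x \<noteq> 0"
    and c: "\<And>i. c i \<in> R" "1 / 2 = (\<Sum>i<Suc n. c i * x ^ i)"
    and d: "\<And>i. d i \<in> R" "1 / 2 = (\<Sum>i<Suc m. d i * inverse x ^ i)"
    and "m \<le> n"
  shows "\<exists>k c'. n = Suc k \<and> (\<forall>i. c' i \<in> R) \<and> 1 / 2 = (\<Sum>i<Suc k. c' i * x ^ i)"
proof -
  have "n \<noteq> 0"
  proof
    assume "n = 0"
    then have "c 0 = 1 / 2" using c(2) by simp
    with half c(1)[of 0] show False by metis
  qed
  then obtain k where k: "n = Suc k" using not0_implies_Suc by blast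
  \<comment> \<open>Solving the relation for its constant term and dividing by the unit
    \<open>1 - 2 * d 0\<close> writes 1 as a combination of the powers 1 to \<open>m\<close> of
    \<open>inverse x\<close>; the zero default pads it up to the power \<open>n\<close>.\<close>
  define e where "e i = (if i < m then 2 * inverse (1 - 2 * d 0) * d (Suc i) else 0)" for i
  have eR: "e i \<in> R" for i unfolding e_def
    using inverse_one_minus_even[OF d(1)] d(1) by (auto intro!: R_closed two_mem)
  have "1 - 2 * d 0 \<noteq> 0"
  proof
    assume "1 - 2 * d 0 = 0"
    then have "d 0 = 1 / 2" by simp
    with half d(1)[of 0] show False by metis
  qed
  moreover have "1 - 2 * d 0 = 2 * (\<Sum>i<m. d (Suc i) * inverse x ^ Suc i)"
    using d(2) unfolding sum.lessThan_Suc_shift by simp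
  ultimately have "1 = inverse (1 - 2 * d 0) * (2 * (\<Sum>i<m. d (Suc i) * inverse x ^ Suc i))"
    by (metis left_inverse)
  also have "\<dots> = (\<Sum>i<m. e i * inverse x ^ Suc i)"
    by (simp add: sum_distrib_left e_def mult_ac)
  also have "\<dots> = (\<Sum>i<Suc k. e i * inverse x ^ Suc i)"
    using \<open>m \<le> n\<close> k by (intro sum.mono_neutral_left) (auto simp: e_def)
  finally have "x ^ Suc k = x ^ Suc k * (\<Sum>i<Suc k. e i * inverse x ^ Suc i)" by simp
  also have "\<dots> = (\<Sum>i<Suc k. e i * x ^ (Suc k - Suc i))"
    unfolding sum_distrib_left
  proof (rule sum.cong)
    fix i assume "i \<in> {..<Suc k}"
    then have pow: "x ^ Suc k = x ^ (Suc k - Suc i) * x ^ Suc i"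
      by (subst power_add[symmetric]) simp
    have inv: "x ^ Suc i * inverse x ^ Suc i = 1"
      using x by (metis power_mult_distrib power_one right_inverse)
    have "x ^ Suc k * (e i * inverse x ^ Suc i) = e i * x ^ (Suc k - Suc i) * (x ^ Suc i * inverse x ^ Suc i)"
      unfolding pow by (simp only: mult_ac)
    then show "x ^ Suc k * (e i * inverse x ^ Suc i) = e i * x ^ (Suc k - Suc i)"
      unfolding inv by simp
  qed auto
  also have "\<dots> = (\<Sum>i<Suc k. e (k - i) * x ^ i)"
    by (subst sum.nat_diff_reindex[symmetric]) (auto intro!: sum.cong)
  finally have top: "x ^ Suc k = (\<Sum>i<Suc k. e (k - i) * x ^ i)" .
  have "1 / 2 = (\<Sum>i<Suc k. c i * x ^ i) + c (Suc k) * x ^ Suc k"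
    using c(2) k by simp
  also have "\<dots> = (\<Sum>i<Suc k. (c i + c (Suc k) * e (k - i)) * x ^ i)"
    unfolding top by (simp only: sum_distrib_left sum.distrib[symmetric]) (simp add: algebra_simps)
  finally have "1 / 2 = (\<Sum>i<Suc k. (c i + c (Suc k) * e (k - i)) * x ^ i)" .
  moreover have "c i + c (Suc k) * e (k - i) \<in> R" for i by (intro R_closed c eR)
  ultimately show ?thesis using k by (intro exI[of _ k] exI[of _ "\<lambda>i. c i + c (Suc k) * e (k - i)"]) auto
qed

text \<open>Otherwise both \<open>x\<close> and its inverse express 1/2 by their powers. Of two such
  relations of minimal length, the one at least as long as the other could be shortened.\<close>

lemma valuation:
  "x \<in> R \<or> inverse x \<in> R"
proof (rule ccontr)
  assume "\<not> (x \<in> R \<or> inverse x \<in> R)"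
  then have nR: "x \<notin> R" "inverse x \<notin> R" by auto
  then have x0: "x \<noteq> 0" using R_closed(4) by auto
  define Q where "Q y n \<longleftrightarrow> (\<exists>c. (\<forall>i. c i \<in> R) \<and> 1 / 2 = (\<Sum>i<Suc n. c i * y ^ i))" for y :: real and n
  have ex: "\<exists>n. Q y n" if "y \<notin> R" for y
    using adjoin_sum_powers[OF subring half_mem_adjoin[OF that]] unfolding Q_def by metis
  have short: "\<exists>k. n = Suc k \<and> Q y k" 
    if y: "y \<noteq> 0" "Q y n" "Q (inverse y) m" "m \<le> n" for y n m
  proof -
    obtain c where c: "\<And>i. c i \<in> R" "1 / 2 = (\<Sum>i<Suc n. c i * y ^ i)"
      using y(2) unfolding Q_def by blast
    obtain d where d: "\<And>i. d i \<in> R" "1 / 2 = (\<Sum>i<Suc m. d i * inverse y ^ i)"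
      using y(3) unfolding Q_def by blast
    from shorten_relation[OF y(1) c d y(4)] show ?thesis unfolding Q_def by blast
  qed
  define n where "n = (LEAST n. Q x n)"
  define m where "m = (LEAST m. Q (inverse x) m)"
  have n: "Q x n" "\<And>k. Q x k \<Longrightarrow> n \<le> k" unfolding n_def using ex[OF nR(1)] by (auto intro: LeastI_ex Least_le)
  have m: "Q (inverse x) m" "\<And>k. Q (inverse x) k \<Longrightarrow> m \<le> k"
    unfolding m_def using ex[OF nR(2)] by (auto intro: LeastI_ex Least_le)
  show False
  proof (cases "m \<le> n")
    case True
    then show False using short[OF x0 n(1) m(1)] n(2) by fastforce
  next
    case False
    then show False using short[of "inverse x" m n] x0 n(1) m by fastforce
  qed
qed

text \<open>By \<open>valuation\<close> these are the nonunits of \<open>R\<close>, its maximal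
  ideal: the elements of positive value.\<close>

definition M :: "real set" where
  "M = {x. x = 0 \<or> inverse x \<notin> R}"

lemma M_sub: "x \<in> M \<Longrightarrow> x \<in> R"
  using valuation R_closed(4) by (auto simp: M_def)

lemma M_mult: "x \<in> M \<Longrightarrow> c \<in> R \<Longrightarrow> c * x \<in> M"
proof (rule ccontr)
  assume x: "x \<in> M" and c: "c \<in> R" and "c * x \<notin> M"
  then have "c * x \<noteq> 0" "inverse (c * x) \<in> R" by (auto simp: M_def)
  then have "c * inverse (c * x) \<in> R" using c R_closed by blast
  moreover have "c * inverse (c * x) = inverse x" using \<open>c * x \<noteq> 0\<close> by simp
  ultimately have "inverse x \<in> R" by metis
  then show False using x \<open>c * x \<noteq> 0\<close> by (simp add: M_def)
qed

lemma M_mult': "x \<in> M \<Longrightarrow> c \<in> R \<Longrightarrow> x * c \<in> M"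
  using M_mult[of x c] by (simp add: mult.commute)

lemma M_minus: "x \<in> M \<Longrightarrow> - x \<in> M"
  using M_mult[of x "-1"] R_closed by simp

text \<open>One of the quotients \<open>x / y\<close> and \<open>y / x\<close> lies in
  \<open>R\<close>, so the sum is a multiple of one summand by an element of
  \<open>R\<close>.\<close>

lemma M_add:
  assumes "x \<in> M" "y \<in> M"
  shows "x + y \<in> M"
proof -
  have *: "x + y \<in> M" if "y \<in> M" "y \<noteq> 0" "x / y \<in> R" for x y
  proof -
    have "(1 + x / y) * y \<in> M" using that R_closed by (intro M_mult) auto
    moreover have "(1 + x / y) * y = x + y" using that by (simp add: field_simps)
    ultimately show ?thesis by simp
  qed
  show ?thesis
  proof (cases "x = 0 \<or> y = 0")
    case False
    then show ?thesis using *[of y x] *[of x y] assms valuation[of "x / y"]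
      by (auto simp: inverse_divide add.commute)
  qed (use assms in auto)
qed

lemma M_diff: "x \<in> M \<Longrightarrow> y \<in> M \<Longrightarrow> x - y \<in> M"
  using M_add[of x "-y"] M_minus by simp

lemma one_notin_M: "1 \<notin> M"
  using R_closed by (auto simp: M_def)

lemma two_in_M: "2 \<in> M"
  using half by (simp add: M_def)

lemma of_int_mem: "real_of_int k \<in> R"
proof -
  have "real n \<in> R" for n by (induction n) (auto intro: R_closed)
  then show ?thesis using R_closed(5) by (cases k) (auto simp del: of_nat_Suc)
qed

lemma inverse_odd_mem: "odd k \<Longrightarrow> inverse (real_of_int k) \<in> R"
  using inverse_one_minus_even[OF of_int_mem[of "- (k div 2)"]]
  by (auto elim!: oddE simp: add.commute)

lemma of_int_in_M_iff: "real_of_int k \<in> M \<longleftrightarrow> even k"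
proof
  assume "even k"
  then obtain l where "k = l * 2" by (auto elim: evenE)
  then show "real_of_int k \<in> M" using M_mult[OF two_in_M of_int_mem[of l]] by simp
next
  assume M: "real_of_int k \<in> M"
  show "even k"
  proof (rule ccontr)
    assume "odd k"
    then have "inverse (real_of_int k) \<in> R" "k \<noteq> 0" using inverse_odd_mem by auto
    then show False using M by (auto simp: M_def)
  qed
qed

section \<open>Monsky's three colours and rainbow triangles\<close>

definition is_A :: "real^2 \<Rightarrow> bool" where
  "is_A p \<longleftrightarrow> p$1 \<in> M \<and> p$2 \<in> M"

text \<open>The first coordinate lies outside \<open>M\<close> and dominates the second. Points
  satisfying neither \<open>is_A\<close> nor \<open>is_B\<close> form the third colour.\<close>

definition is_B :: "real^2 \<Rightarrow> bool" where
  "is_B p \<longleftrightarrow> \<not> is_A p \<and> p$1 \<noteq> 0 \<and> p$2 / p$1 \<in> R"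

lemma is_B_D:
  assumes "is_B p"
  shows "p$1 \<noteq> 0" "p$2 / p$1 \<in> R" "inverse (p$1) \<in> R"
proof -
  show "p$1 \<noteq> 0" "p$2 / p$1 \<in> R" using assms by (auto simp: is_B_def)
  show "inverse (p$1) \<in> R"
  proof (rule ccontr)
    assume "inverse (p$1) \<notin> R"
    then have 1: "p$1 \<in> M" by (simp add: M_def)
    then have "p$2 / p$1 * p$1 \<in> M" using M_mult \<open>p$2 / p$1 \<in> R\<close> by blast
    then show False using 1 assms by (simp add: is_B_def is_A_def)
  qed
qed

lemma not_AB_D:
  assumes "\<not> is_A p" "\<not> is_B p"
  shows "p$2 \<noteq> 0" "p$1 / p$2 \<in> M" "inverse (p$2) \<in> R"
proof -
  have *: "p$1 = 0 \<or> p$2 / p$1 \<notin> R" using assms by (auto simp: is_B_def)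
  then show 0: "p$2 \<noteq> 0" using assms(1) R_closed(4) by (auto simp: is_A_def M_def)
  show m: "p$1 / p$2 \<in> M" using * by (auto simp: M_def)
  show "inverse (p$2) \<in> R"
  proof (rule ccontr)
    assume "inverse (p$2) \<notin> R"
    then have 2: "p$2 \<in> M" by (simp add: M_def)
    then have "p$1 / p$2 * p$2 \<in> M" using M_mult M_sub m by blast
    then show False using 2 0 assms by (simp add: is_A_def)
  qed
qed

text \<open>In the determinant the term \<open>b$1 * c$2\<close> dominates: after division by it,
  every other term has a factor \<open>a$1\<close>, \<open>a$2\<close> or \<open>c$1 / c$2\<close>
  from \<open>M\<close> and its remaining factors in \<open>R\<close>.\<close>

lemma rainbow_orient:
  assumes a: "is_A a" and b: "is_B b" and c: "\<not> is_A c" "\<not> is_B c"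
  shows "orient a b c \<notin> M"
proof
  note b' = is_B_D[OF b] and c' = not_AB_D[OF c]
  define \<mu> where "\<mu> = b$2 / b$1 * (c$1 / c$2) + a$1 * inverse (b$1) - a$1 * (b$2 / b$1 * inverse (c$2))
     - a$2 * (c$1 / c$2 * inverse (b$1)) + a$2 * inverse (c$2)"
  have eq: "orient a b c * (inverse (b$1) * inverse (c$2)) = 1 - \<mu>"
    unfolding orient_def cross2_def \<mu>_def using b'(1) c'(1) by (simp add: field_simps)
  assume "orient a b c \<in> M"
  then have "1 - \<mu> \<in> M" unfolding eq[symmetric] using b' c' by (intro M_mult' R_closed)
  moreover have "\<mu> \<in> M" unfolding \<mu>_def
    using a b' c' by (intro M_add M_diff M_mult[of "c$1 / c$2"] M_mult'[of "a$1"] M_mult'[of "a$2"] R_closed)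
      (auto simp: is_A_def intro: M_sub)
  ultimately have "1 - \<mu> + \<mu> \<in> M" by (rule M_add)
  then show False using one_notin_M by simp
qed

definition AB_count :: "real^2 \<Rightarrow> real^2 \<Rightarrow> real" where
  "AB_count p q = of_bool (is_A p \<and> is_B q) - of_bool (is_B p \<and> is_A q)"

text \<open>With at most two colours, passages from A to B and back cancel around the triangle. A
  nonzero count forces all three colours, which \<open>rainbow_orient\<close> excludes in each of
  the six arrangements.\<close>

lemma AB_count_triangle:
  assumes "orient a b c \<in> M"
  shows "AB_count a b + AB_count b c + AB_count c a = 0"
proof (rule ccontr)
  assume nz: "AB_count a b + AB_count b c + AB_count c a \<noteq> 0"
  have AB: "\<not> (is_A p \<and> is_B p)" for p by (simp add: is_B_def)
  define C where "C p \<longleftrightarrow> \<not> is_A p \<and> \<not> is_B p" for p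
  have "is_A a \<and> is_B b \<and> C c \<or> is_A a \<and> is_B c \<and> C b \<or> is_A b \<and> is_B a \<and> C c \<or>
    is_A b \<and> is_B c \<and> C a \<or> is_A c \<and> is_B a \<and> C b \<or> is_A c \<and> is_B b \<and> C a"
    using nz AB[of a] AB[of b] AB[of c] unfolding AB_count_def C_def
    by (cases "is_A a"; cases "is_B a"; cases "is_A b"; cases "is_B b"; cases "is_A c"; cases "is_B c"; simp)
  moreover have "orient b a c = - orient a b c" "orient a c b = - orient a b c" "orient c b a = - orient a b c"
    "orient b c a = orient a b c" "orient c a b = orient a b c"
    by (simp_all add: orient_def cross2_def algebra_simps)
  ultimately show False
    using rainbow_orient[of a b c] rainbow_orient[of a c b] rainbow_orient[of b a c]
      rainbow_orient[of b c a] rainbow_orient[of c a b] rainbow_orient[of c b a] assms M_minus[OF assms]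
    unfolding C_def by auto
qed

lemma is_A_int: "p$1 = real_of_int x \<Longrightarrow> p$2 = real_of_int y \<Longrightarrow> is_A p \<longleftrightarrow> even x \<and> even y"
  by (simp add: is_A_def of_int_in_M_iff)

text \<open>An odd integer is a unit of \<open>R\<close> and an even one lies in \<open>M\<close>,
  so the colours of lattice points depend on parities only.\<close>

lemma is_B_int:
  assumes "p$1 = real_of_int x" "p$2 = real_of_int y"
  shows "is_B p \<longleftrightarrow> odd x"
proof
  assume "odd x"
  then have "real_of_int y * inverse (real_of_int x) \<in> R"
    by (intro R_closed of_int_mem inverse_odd_mem)
  moreover have "x \<noteq> 0" using \<open>odd x\<close> by auto
  ultimately show "is_B p" using assms \<open>odd x\<close> is_A_int[OF assms] by (simp add: is_B_def divide_inverse)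
next
  assume B: "is_B p"
  then have "real_of_int x \<notin> M" using is_B_D[OF B] assms by (simp add: M_def)
  then show "odd x" by (simp add: of_int_in_M_iff)
qed

end

section \<open>Rearranging lattice paths modulo 4\<close>

primrec path_sum :: "('a::ab_group_add \<Rightarrow> 'a \<Rightarrow> int) \<Rightarrow> 'a \<Rightarrow> 'a list \<Rightarrow> int" where
  "path_sum F p [] = 0"
| "path_sum F p (d # ds) = F p d + path_sum F (p + d) ds"

locale commuting_steps =
  fixes F :: "'a::ab_group_add \<Rightarrow> 'a \<Rightarrow> int" and N :: int
  assumes commute: "N dvd F p a + F (p + a) b - (F p b + F (p + b) a)"
    and retrace: "F p a + F (p + a) (- a) = 0"
begin

text \<open>Both orders of two steps lead to the same point, so an exchange affects no later term;
  repeated exchanges bring \<open>a\<close> to the front.\<close>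

lemma path_sum_move: "N dvd path_sum F p (xs @ a # ys) - path_sum F p (a # xs @ ys)"
proof (induction xs arbitrary: p)
  case (Cons b xs)
  have "N dvd (path_sum F (p + b) (xs @ a # ys) - path_sum F (p + b) (a # xs @ ys))
      + (F p b + F (p + b) a - (F p a + F (p + a) b))"
    by (intro dvd_add Cons commute)
  then show ?case by (simp add: algebra_simps)
qed simp

lemma path_sum_perm:
  assumes "mset xs = mset ys"
  shows "N dvd path_sum F p xs - path_sum F p ys"
  using assms
proof (induction xs arbitrary: p ys)
  case (Cons a xs)
  then have "a \<in> set ys" by (metis list.set_intros(1) mset_eq_setD)
  then obtain us vs where ys: "ys = us @ a # vs" by (auto simp: in_set_conv_decomp)
  with Cons.prems have "mset xs = mset (us @ vs)" by simp
  from Cons.IH[OF this, of "p + a"]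
  have "N dvd path_sum F p (a # xs) - path_sum F p (a # us @ vs)" by simp
  from dvd_diff[OF this path_sum_move[of p us a vs]]
  show ?case unfolding ys by (simp del: path_sum.simps)
qed simp

lemma path_sum_pairs: "path_sum F p (concat (map (\<lambda>d. [d, - d]) ds)) = 0"
  using retrace by (induction ds arbitrary: p) (auto simp: add.assoc[symmetric])

end

text \<open>Turns the partition of indices in \<open>balanced\<close> into an equality of multisets
  of steps, the form that \<open>path_sum_perm\<close> asks for.\<close>

lemma paired_mset:
  fixes f :: "nat \<Rightarrow> 'a::ab_group_add"
  assumes "partition_on {..<n} P"
    and "\<forall>p\<in>P. \<exists>i j. i \<noteq> j \<and> p = {i, j} \<and> f j = - f i"
  shows "\<exists>ds. mset (map f [0..<n]) = mset (concat (map (\<lambda>d. [d, - d]) ds))"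
proof -
  have fin: "finite P" using assms(1) finite_elements by blast
  \<comment> \<open>Stated for all subfamilies of the partition, to allow induction over its
    blocks.\<close>
  have "\<exists>ds. image_mset f (mset_set (\<Union>Q)) = mset (concat (map (\<lambda>d. [d, - d]) ds))" if "Q \<subseteq> P" for Q
  proof -
    have "finite Q" using that fin finite_subset by blast
    then show ?thesis using that
    proof (induction Q)
      case empty
      show ?case by (intro exI[of _ "[]"]) simp
    next
      case (insert p Q)
      have "Q \<subseteq> P" using insert.prems by blast
      from insert.IH[OF this] obtain ds
        where ds: "image_mset f (mset_set (\<Union>Q)) = mset (concat (map (\<lambda>d. [d, - d]) ds))" ..
      obtain i j where ij: "i \<noteq> j" "p = {i, j}" "f j = - f i" using assms(2) insert.prems by blast
      have "p \<inter> q = {}" if "q \<in> Q" for q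
        using disjointD[OF partition_onD2[OF assms(1)], of p q] that insert by blast
      then have "p \<inter> \<Union>Q = {}" by blast
      moreover have "finite p" "finite (\<Union>Q)"
        using assms(1) insert.prems unfolding partition_on_def
        by (auto intro: finite_subset[of _ "{..<n}"])
      ultimately have "mset_set (\<Union>(insert p Q)) = mset_set p + mset_set (\<Union>Q)"
        by (simp add: mset_set_Union)
      then have "image_mset f (mset_set (\<Union>(insert p Q))) = mset (concat (map (\<lambda>d. [d, - d]) (f i # ds)))"
        using ds ij by simp
      then show ?case by blast
    qed
  qed
  from this[OF order_refl]
  have "\<exists>ds. image_mset f (mset_set {..<n}) = mset (concat (map (\<lambda>d. [d, - d]) ds))"
    unfolding partition_onD1[OF assms(1), symmetric] .
  moreover have "mset_set {..<n} = mset [0..<n]"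
    by (metis atLeast_upt distinct_upt mset_set_set)
  ultimately show ?thesis by simp
qed

lemma path_sum_vertices:
  "path_sum F (q k) (map (\<lambda>i. q (Suc i) - q i) [k..<k + l]) = (\<Sum>i=k..<k + l. F (q i) (q (Suc i) - q i))"
proof (induction l arbitrary: k)
  case (Suc l)
  have "[k..<k + Suc l] = k # [Suc k..<Suc k + l]" "{k..<k + Suc l} = insert k {Suc k..<Suc k + l}"
    by (auto simp: upt_conv_Cons simp del: upt_Suc)
  with Suc[of "Suc k"] show ?case by simp
qed simp

section \<open>Parity colours of lattice points against area modulo 4\<close>

definition parity_A :: "int \<times> int \<Rightarrow> bool" where
  "parity_A p \<longleftrightarrow> even (fst p) \<and> even (snd p)"

text \<open>The integer form of \<open>AB_count\<close> on lattice points, where the second colour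
  means an odd first coordinate.\<close>

definition parity_count :: "int \<times> int \<Rightarrow> int \<times> int \<Rightarrow> int" where
  "parity_count p q = of_bool (parity_A p \<and> odd (fst q)) - of_bool (odd (fst p) \<and> parity_A q)"

text \<open>A translation, which preserves areas but permutes the residue classes modulo 2 and so
  yields another colouring.\<close>

definition shift :: "int \<times> int \<Rightarrow> int \<times> int" where "shift p = (fst p - 1, snd p)"

definition int_cross :: "int \<times> int \<Rightarrow> int \<times> int \<Rightarrow> int" where
  "int_cross p q = fst p * snd q - snd p * fst q"

text \<open>The coefficients are chosen such that, modulo \<open>4\<close>, the boundaries of the four triangles
  formed by the residue classes of \<open>\<int>\<^sup>2\<close> modulo \<open>2\<close> all get the same odd value when these
  triangles are oriented as the faces of a tetrahedron.  Exchanging two consecutive steps then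
  changes this count by \<open>2\<close> modulo \<open>4\<close> exactly when it changes the area by an odd amount.\<close>

definition weighted_count :: "int \<times> int \<Rightarrow> int \<times> int \<Rightarrow> int" where
  "weighted_count p q = parity_count p q + parity_count (shift p) (shift q)
     + 2 * parity_count (prod.swap p) (prod.swap q)"

text \<open>The contribution of one step to twice the signed area minus the colour count, as a
  function of position and step to suit \<open>path_sum\<close>.\<close>

definition defect :: "int \<times> int \<Rightarrow> int \<times> int \<Rightarrow> int" where
  "defect p d = int_cross p (p + d) - weighted_count p (p + d)"

text \<open>The exchange of two steps sweeps the parallelogram spanned by them, and the sum counts
  areas twice.\<close>

lemma parity_cross:
  "int_cross p (p + a) + int_cross (p + a) (p + a + b) - (int_cross p (p + b) + int_cross (p + b) (p + b + a))
    = 2 * int_cross a b"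
  by (cases p; cases a; cases b) (simp add: int_cross_def algebra_simps)

text \<open>The colour part depends on residues modulo 2 only and is checked in all 64 cases: it
  changes, modulo 4, by twice the determinant of the two steps, exactly like the area part.\<close>

lemma commuting_defect: "4 dvd defect p a + defect (p + a) b - (defect p b + defect (p + b) a)"
proof -
  obtain p1 p2 a1 a2 b1 b2 where p: "p = (p1, p2)" "a = (a1, a2)" "b = (b1, b2)"
    by (cases p; cases a; cases b)
  define W where "W = weighted_count p (p + a) + weighted_count (p + a) (p + a + b)
    - (weighted_count p (p + b) + weighted_count (p + b) (p + b + a))"
  have "4 dvd 2 * of_bool (odd a1 \<and> odd b2) - 2 * of_bool (odd a2 \<and> odd b1) - W"
    unfolding W_def weighted_count_def parity_count_def parity_A_def shift_def p
    by (simp only: fst_conv snd_conv fst_swap snd_swap prod.swap_def plus_prod_def split_beta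
          even_diff even_add odd_one simp_thms)
      (cases "even p1"; cases "even p2"; cases "even a1"; cases "even a2"; cases "even b1"; cases "even b2";
        simp only: simp_thms of_bool_eq; simp)
  moreover have "4 dvd 2 * int_cross a b - (2 * of_bool (odd a1 \<and> odd b2) - 2 * of_bool (odd a2 \<and> odd b1))"
  proof -
    have "even (int_cross a b - (of_bool (odd a1 \<and> odd b2) - of_bool (odd a2 \<and> odd b1)))"
      by (simp add: int_cross_def p)
    then obtain k where "int_cross a b - (of_bool (odd a1 \<and> odd b2) - of_bool (odd a2 \<and> odd b1)) = 2 * k" ..
    then have "2 * int_cross a b - (2 * of_bool (odd a1 \<and> odd b2) - 2 * of_bool (odd a2 \<and> odd b1)) = 4 * k"
      by linarith
    then show ?thesis by simp
  qed
  ultimately have "4 dvd (2 * of_bool (odd a1 \<and> odd b2) - 2 * of_bool (odd a2 \<and> odd b1) - W) +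
      (2 * int_cross a b - (2 * of_bool (odd a1 \<and> odd b2) - 2 * of_bool (odd a2 \<and> odd b1)))"
    by (rule dvd_add)
  then have "4 dvd 2 * int_cross a b - W" by simp
  moreover have "defect p a + defect (p + a) b - (defect p b + defect (p + b) a) = 2 * int_cross a b - W"
    using parity_cross[of p a b] unfolding defect_def W_def by linarith
  ultimately show ?thesis by simp
qed

interpretation defect: commuting_steps defect 4
proof
  show "4 dvd defect p a + defect (p + a) b - (defect p b + defect (p + b) a)" for p a b
    by (rule commuting_defect)
  \<comment> \<open>Both parts of the defect are antisymmetric, so a step walked back
    cancels.\<close>
  have count: "parity_count q p = - parity_count p q" for p q
    by (simp only: parity_count_def conj_commute minus_diff_eq)
  have "weighted_count (p + a) p = - weighted_count p (p + a)" for p a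
    unfolding weighted_count_def count[of "p + a" p] count[of "shift (p + a)" "shift p"]
      count[of "prod.swap (p + a)" "prod.swap p"] by simp
  moreover have "int_cross (p + a) p = - int_cross p (p + a)" for p a
    by (simp add: int_cross_def)
  ultimately show "defect p a + defect (p + a) (- a) = 0" for p a
    by (simp add: defect_def)
qed

text \<open>The steps are rearranged so that each is followed at once by its opposite. There the
  defect sum is zero, and the rearrangement alters it only by a multiple of 4.\<close>

lemma balanced_closed_path:
  fixes q :: "nat \<Rightarrow> int \<times> int"
  assumes "partition_on {..<n} P"
    and "\<forall>p\<in>P. \<exists>i j. i \<noteq> j \<and> p = {i, j} \<and> q (Suc j) - q j = - (q (Suc i) - q i)"
  shows "4 dvd (\<Sum>i<n. int_cross (q i) (q (Suc i))) - (\<Sum>i<n. weighted_count (q i) (q (Suc i)))"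
proof -
  obtain ds where "mset (map (\<lambda>i. q (Suc i) - q i) [0..<n]) = mset (concat (map (\<lambda>d. [d, - d]) ds))"
    using paired_mset[OF assms] by auto
  from defect.path_sum_perm[OF this, of "q 0"]
  have "4 dvd path_sum defect (q 0) (map (\<lambda>i. q (Suc i) - q i) [0..<n])"
    by (simp only: defect.path_sum_pairs diff_0_right)
  also have "path_sum defect (q 0) (map (\<lambda>i. q (Suc i) - q i) [0..<n]) = (\<Sum>i<n. defect (q i) (q (Suc i) - q i))"
    using path_sum_vertices[of defect q 0 n] by (simp add: atLeast0LessThan)
  also have "\<dots> = (\<Sum>i<n. int_cross (q i) (q (Suc i))) - (\<Sum>i<n. weighted_count (q i) (q (Suc i)))"
    by (simp add: defect_def sum_subtractf)
  finally show ?thesis .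
qed

section \<open>Balanced lattice polygons\<close>

text \<open>A coboundary sums to zero around every triangle. For the indicator of a vertex this
  equates the coefficients of the two edges at that vertex. The value 0 of \<open>s\<close> is
  excluded later, by the area.\<close>

lemma (in dissection) dissection_chain_cyclic:
  assumes closed: "\<And>i. i < n \<Longrightarrow> w i = v (Suc i mod n)" and inj: "inj_on v {..<n}"
  obtains s where "s \<in> {-1, 0, 1}"
    "\<And>\<sigma>. chain_additive \<sigma> \<Longrightarrow>
      (\<Sum>j<m. sgn (orient (p j) (q j) (r j)) * (\<sigma> (p j) (q j) + \<sigma> (q j) (r j) + \<sigma> (r j) (p j)))
        = s * (\<Sum>i<n. \<sigma> (v i) (w i))"
proof -
  have step: "edge_sign (Suc i) = edge_sign i" if i: "Suc i < n" for i
  proof -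
    \<comment> \<open>The indicator of the vertex between the edges \<open>i\<close> and
      \<open>Suc i\<close>.\<close>
    define f :: "real^2 \<Rightarrow> real" where "f x = of_bool (x = v (Suc i))" for x
    have "chain_additive (\<lambda>a b. f b - f a)" by (simp add: chain_additive_def)
    from dissection_chain[OF this] have "(\<Sum>k<n. edge_sign k * (f (w k) - f (v k))) = 0" by simp
    moreover have "f (w k) = of_bool (k = i)" "f (v k) = of_bool (k = Suc i)" if k: "k < n" for k
    proof -
      have "Suc k mod n = Suc i \<longleftrightarrow> k = i" using k i by (cases "Suc k = n") auto
      then show "f (w k) = of_bool (k = i)" "f (v k) = of_bool (k = Suc i)"
        using inj k i inj_on_eq_iff[OF inj, of "Suc k mod n" "Suc i"] inj_on_eq_iff[OF inj, of k "Suc i"]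
        by (auto simp: f_def closed)
    qed
    ultimately have "(\<Sum>k<n. edge_sign k * (of_bool (k = i) - of_bool (k = Suc i))) = 0" by simp
    moreover have "(\<Sum>k<n. edge_sign k * of_bool (k = j)) = edge_sign j" if "j < n" for j
    proof -
      have "(\<Sum>k<n. edge_sign k * of_bool (k = j)) = (\<Sum>k<n. if k = j then edge_sign k else 0)"
        by (intro sum.cong) auto
      then show ?thesis using that by simp
    qed
    from this[OF Suc_lessD[OF i]] this[OF i]
    have "(\<Sum>k<n. edge_sign k * (of_bool (k = i) - of_bool (k = Suc i))) = edge_sign i - edge_sign (Suc i)"
      by (simp only: right_diff_distrib sum_subtractf)
    ultimately show ?thesis by simp
  qed
  have const: "edge_sign i = edge_sign 0" if "i < n" for i
    using that by (induction i) (auto simp: step)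
  show thesis
  proof (rule that[of "edge_sign 0"])
    show "edge_sign 0 \<in> {-1, 0, 1}" by (rule edge_sign_cases)
    fix \<sigma> assume "chain_additive \<sigma>"
    moreover have "(\<Sum>i<n. edge_sign i * \<sigma> (v i) (w i)) = edge_sign 0 * (\<Sum>i<n. \<sigma> (v i) (w i))"
      unfolding sum_distrib_left by (intro sum.cong refl arg_cong2[of _ _ _ _ "(*)"] const) simp
    ultimately show "(\<Sum>j<m. sgn (orient (p j) (q j) (r j)) * (\<sigma> (p j) (q j) + \<sigma> (q j) (r j) + \<sigma> (r j) (p j)))
        = edge_sign 0 * (\<Sum>i<n. \<sigma> (v i) (w i))"
      using dissection_chain by simp
  qed
qed

section \<open>Area and colour count as additive functionals\<close>

lemma chain_additive_cross2: "chain_additive cross2"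
  by (auto simp: chain_additive_def orient_def cross2_def algebra_simps)

lemma area_triangle: "area (convex hull {a, b, c}) = \<bar>orient a b c\<bar> / 2"
proof -
  have "convex hull {a, b, c} \<in> sets borel"
    by (simp add: compact_convex_hull borel_compact)
  then have "area (convex hull {a, b, c}) = measure lborel (convex hull {a, b, c})"
    by (simp add: measure_completion)
  also have "\<dots> = \<bar>orient a b c\<bar> / 2"
    unfolding content_triangle by (simp add: orient_def cross2_def abs_minus_commute mult.commute)
  finally show ?thesis .
qed

text \<open>Two triangles with disjoint interiors meet in a convex set without interior, which is
  negligible.\<close>

lemma (in dissection) area_dissection: "area B = (\<Sum>j<m. area (tri j))"
  unfolding cover
proof (rule measure_negligible_finite_Union_image)
  show "tri j \<in> lmeasurable" for j
    by (simp add: compact_convex_hull lmeasurable_compact)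
  show "pairwise (\<lambda>j k. negligible (tri j \<inter> tri k)) {..<m}"
  proof (rule pairwiseI)
    fix j k assume "j \<in> {..<m}" "k \<in> {..<m}" "j \<noteq> k"
    then have "interior (tri j \<inter> tri k) = {}" using interiors by simp
    then show "negligible (tri j \<inter> tri k)"
      by (simp add: negligible_convex_interior convex_Int)
  qed
qed simp

context maximal_subring
begin

text \<open>Applied to translations and reflections \<open>g\<close>, which at most change the sign
  of \<open>orient\<close>. Degenerate triangles are never rainbow because 0 lies in
  \<open>M\<close>.\<close>

lemma chain_additive_AB_count:
  assumes "\<And>a b c. orient (g a) (g b) (g c) = orient a b c \<or> orient (g a) (g b) (g c) = - orient a b c"
  shows "chain_additive (\<lambda>a b. AB_count (g a) (g b))"
  unfolding chain_additive_def
proof (intro allI impI)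
  fix a b c assume "orient a b c = 0"
  then have "orient (g a) (g b) (g c) = 0" using assms[of a b c] by auto
  then show "AB_count (g a) (g b) + AB_count (g b) (g c) + AB_count (g c) (g a) = 0"
    by (intro AB_count_triangle) (simp add: M_def)
qed

lemma AB_count_int:
  assumes "p$1 = real_of_int (fst x)" "p$2 = real_of_int (snd x)"
    and "q$1 = real_of_int (fst y)" "q$2 = real_of_int (snd y)"
  shows "AB_count p q = of_int (parity_count x y)"
  using is_A_int[OF assms(1,2)] is_A_int[OF assms(3,4)] is_B_int[OF assms(1,2)] is_B_int[OF assms(3,4)]
  by (simp add: AB_count_def parity_count_def parity_A_def of_bool_def)

end

theorem theorem2:
  fixes vs :: "(real^2) list"
  assumes "simple_polygon vs"
    and "balanced vs"
    and "\<forall>v\<in>set vs. \<forall>i. v $ i \<in> \<int>"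
    and "\<exists>k::int. odd k \<and> area (polygon_region vs) = of_int k"
  shows "\<not> (\<exists>ts. cut_into_triangles (polygon_region vs) ts \<and> odd (length ts) \<and>
                 (\<forall>s\<in>set ts. \<forall>t\<in>set ts. area (triangle s) = area (triangle t)))"
proof
  assume "\<exists>ts. cut_into_triangles (polygon_region vs) ts \<and> odd (length ts) \<and>
                 (\<forall>s\<in>set ts. \<forall>t\<in>set ts. area (triangle s) = area (triangle t))"
  then obtain ts where cut: "cut_into_triangles (polygon_region vs) ts" and odd_ts: "odd (length ts)"
    and equal: "\<And>s t. s \<in> set ts \<Longrightarrow> t \<in> set ts \<Longrightarrow> area (triangle s) = area (triangle t)"
    by blast
  obtain k :: int where k: "odd k" "area (polygon_region vs) = of_int k" using assms(4) by blast
  define n where "n = length vs"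
  define m where "m = length ts"
  have n3: "n \<ge> 3" using assms(1) by (simp add: n_def simple_polygon_def)
  have tri: "convex hull {fst (ts ! j), fst (snd (ts ! j)), snd (snd (ts ! j))} = triangle (ts ! j)" for j
    by (simp add: triangle_def split_beta)
  have set_ts: "set ts = (\<lambda>j. ts ! j) ` {..<m}" by (auto simp: m_def set_conv_nth)
  have dist: "distinct vs" using simple_polygon_edges[OF assms(1)] by blast
  have vw: "nxt vs i = vs ! (Suc i mod n)" for i by (simp add: nxt_def n_def)
  interpret dissection n "\<lambda>i. vs ! i" "nxt vs" "polygon_region vs" m
    "\<lambda>j. fst (ts ! j)" "\<lambda>j. fst (snd (ts ! j))" "\<lambda>j. snd (snd (ts ! j))"
  proof
    show "frontier (polygon_region vs) \<subseteq> (\<Union>i<n. closed_segment (vs ! i) (nxt vs i))"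
      using frontier_polygon_region[OF assms(1)] path_image_boundary_path[of vs] n3 by (simp add: n_def)
    show "vs ! i \<noteq> nxt vs i" if "i < n" for i
    proof -
      have "Suc i mod n \<noteq> i" "Suc i mod n < n" using that n3 by (cases "Suc i = n"; simp)+
      then show ?thesis unfolding vw using dist that by (simp add: nth_eq_iff_index_eq n_def)
    qed
    show "open_segment (vs ! i) (nxt vs i) \<inter> closed_segment (vs ! j) (nxt vs j) = {}"
      if "i < n" "j < n" "i \<noteq> j" for i j
      using simple_polygon_edges(2)[OF assms(1)] that by (simp add: n_def)
    show "polygon_region vs = (\<Union>j<m. convex hull {fst (ts ! j), fst (snd (ts ! j)), snd (snd (ts ! j))})"
      using cut unfolding tri cut_into_triangles_def set_ts by (simp add: image_image)
    show "interior (convex hull {fst (ts ! i), fst (snd (ts ! i)), snd (snd (ts ! i))}) \<inter>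
       interior (convex hull {fst (ts ! j), fst (snd (ts ! j)), snd (snd (ts ! j))}) = {}"
      if "i < m" "j < m" "i \<noteq> j" for i j
      using cut that unfolding tri cut_into_triangles_def m_def by blast
  qed
  define D where "D j = orient (fst (ts ! j)) (fst (snd (ts ! j))) (snd (snd (ts ! j)))" for j
  have "inj_on (\<lambda>i. vs ! i) {..<n}" using dist by (simp add: inj_on_nth n_def)
  then obtain s where s: "s \<in> {-1, 0, 1}" and chain: "\<And>\<sigma>. chain_additive \<sigma> \<Longrightarrow>
      (\<Sum>j<m. sgn (D j) * (\<sigma> (fst (ts ! j)) (fst (snd (ts ! j))) +
          \<sigma> (fst (snd (ts ! j))) (snd (snd (ts ! j))) + \<sigma> (snd (snd (ts ! j))) (fst (ts ! j))))
        = s * (\<Sum>i<n. \<sigma> (vs ! i) (nxt vs i))"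
    using dissection_chain_cyclic vw unfolding D_def by blast
  \<comment> \<open>The shoelace sum; times \<open>s\<close> it is twice the area.\<close>
  define Sh where "Sh = (\<Sum>i<n. cross2 (vs ! i) (nxt vs i))"
  have area_tri: "area (triangle (ts ! j)) = \<bar>D j\<bar> / 2" for j
    unfolding tri[symmetric] D_def by (rule area_triangle)
  have area_sum: "of_int k = (\<Sum>j<m. area (triangle (ts ! j)))"
    using area_dissection unfolding tri k(2) .
  have "(\<Sum>j<m. \<bar>D j\<bar>) = s * Sh"
  proof -
    have "cross2 a b + cross2 b c + cross2 c a = orient a b c" for a b c
      by (simp add: orient_def cross2_def algebra_simps)
    with chain[OF chain_additive_cross2] show ?thesis by (simp add: Sh_def D_def abs_sgn mult.commute)
  qed
  then have area_Sh: "of_int k = s * Sh / 2"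
    using area_sum unfolding area_tri sum_divide_distrib[symmetric] by simp
  obtain R where "maximal_subring R"
    using exists_maximal_subring unfolding maximal_subring_def by blast
  then interpret maximal_subring R .
  \<comment> \<open>Each triangle has area \<open>k / m\<close>. The inverse of the odd number
    \<open>m\<close> lies in \<open>R\<close>, so \<open>D j\<close> is twice an element of
    \<open>R\<close> up to sign.\<close>
  have D_M: "D j \<in> M" if j: "j < m" for j
  proof -
    have "area (triangle (ts ! i)) = area (triangle (ts ! j))" if "i < m" for i
      using equal[of "ts ! i" "ts ! j"] that j by (simp add: m_def)
    then have "real_of_int k = real m * (\<bar>D j\<bar> / 2)" unfolding area_sum area_tri by simp
    then have "\<bar>D j\<bar> = real_of_int k * inverse (real_of_int (int m)) * 2"
      using j by (simp add: field_simps)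
    moreover have "inverse (real_of_int (int m)) \<in> R"
      using odd_ts by (intro inverse_odd_mem) (simp add: m_def)
    ultimately have "\<bar>D j\<bar> \<in> M"
      using M_mult[OF two_in_M R_closed(3)[OF of_int_mem[of k]]] by metis
    then show ?thesis using M_minus[of "\<bar>D j\<bar>"] by (cases "D j \<ge> 0") auto
  qed
  \<comment> \<open>An odd area is not zero.\<close>
  have "s \<noteq> 0" using area_Sh k(1) by auto
  have no_rainbow: "(\<Sum>i<n. AB_count (g (vs ! i)) (g (nxt vs i))) = 0"
    if g: "\<And>a b c. orient (g a) (g b) (g c) = orient a b c \<or> orient (g a) (g b) (g c) = - orient a b c" for g
  proof -
    have "AB_count (g (fst (ts ! j))) (g (fst (snd (ts ! j)))) +
          AB_count (g (fst (snd (ts ! j)))) (g (snd (snd (ts ! j)))) +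
          AB_count (g (snd (snd (ts ! j)))) (g (fst (ts ! j))) = 0" if "j < m" for j
    proof (rule AB_count_triangle)
      show "orient (g (fst (ts ! j))) (g (fst (snd (ts ! j)))) (g (snd (snd (ts ! j)))) \<in> M"
        using D_M[OF that] M_minus[OF D_M[OF that]] g unfolding D_def by metis
    qed
    then have "s * (\<Sum>i<n. AB_count (g (vs ! i)) (g (nxt vs i))) = 0"
      using chain[OF chain_additive_AB_count[OF g]] by simp
    then show ?thesis using \<open>s \<noteq> 0\<close> by simp
  qed
  \<comment> \<open>Reducing the index modulo \<open>n\<close> makes \<open>z n\<close> the first
    vertex again, so that the edges run from \<open>z i\<close> to \<open>z (Suc i)\<close>;
    rounding is exact at lattice points.\<close>
  define z :: "nat \<Rightarrow> int \<times> int" where "z i = (\<lfloor>vs ! (i mod n) $ 1\<rfloor>, \<lfloor>vs ! (i mod n) $ 2\<rfloor>)" for i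
  have z: "vs ! (i mod n) $ 1 = of_int (fst (z i))" "vs ! (i mod n) $ 2 = of_int (snd (z i))" for i
  proof -
    have "i mod n < n" using n3 by (intro mod_less_divisor) simp
    then have "vs ! (i mod n) \<in> set vs" by (simp add: n_def)
    then show "vs ! (i mod n) $ 1 = of_int (fst (z i))" "vs ! (i mod n) $ 2 = of_int (snd (z i))"
      using assms(3) by (auto simp: z_def)
  qed
  have zi: "vs ! i $ 1 = of_int (fst (z i))" "vs ! i $ 2 = of_int (snd (z i))" if "i < n" for i
    using z[of i] that by simp_all
  have zw: "nxt vs i $ 1 = of_int (fst (z (Suc i)))" "nxt vs i $ 2 = of_int (snd (z (Suc i)))" for i
    unfolding vw by (rule z)+
  \<comment> \<open>Here \<open>f\<close> is the effect of the plane map \<open>g\<close> on integer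
    coordinates.\<close>
  have count: "(\<Sum>i<n. parity_count (f (z i)) (f (z (Suc i)))) = 0"
    if f: "\<And>p x. p$1 = of_int (fst x) \<Longrightarrow> p$2 = of_int (snd x) \<Longrightarrow>
        g p $ 1 = of_int (fst (f x)) \<and> g p $ 2 = of_int (snd (f x))"
      and g: "\<And>a b c. orient (g a) (g b) (g c) = orient a b c \<or> orient (g a) (g b) (g c) = - orient a b c"
    for f and g :: "real^2 \<Rightarrow> real^2"
  proof -
    have "real_of_int (\<Sum>i<n. parity_count (f (z i)) (f (z (Suc i)))) =
        (\<Sum>i<n. AB_count (g (vs ! i)) (g (nxt vs i)))"
      unfolding of_int_sum
    proof (rule sum.cong)
      fix i assume "i \<in> {..<n}"
      then have "i < n" by simp
      show "real_of_int (parity_count (f (z i)) (f (z (Suc i)))) = AB_count (g (vs ! i)) (g (nxt vs i))"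
        using AB_count_int[of "g (vs ! i)" "f (z i)" "g (nxt vs i)" "f (z (Suc i))"]
          f[OF zi[OF \<open>i < n\<close>]] f[OF zw] by simp
    qed simp
    then show ?thesis unfolding no_rainbow[OF g] by (simp only: of_int_eq_0_iff)
  qed
  \<comment> \<open>The identity, a translation and the reflection in the diagonal preserve or
    reverse \<open>orient\<close>; they supply the three counts in
    \<open>weighted_count\<close>.\<close>
  have "(\<Sum>i<n. parity_count (z i) (z (Suc i))) = 0"
    using count[of "\<lambda>p. p" "\<lambda>x. x"] by simp
  moreover have "(\<Sum>i<n. parity_count (shift (z i)) (shift (z (Suc i)))) = 0"
    by (rule count[of "\<lambda>p. \<chi> i. if i = 1 then p$1 - 1 else p$2"])
      (simp_all add: shift_def orient_def cross2_def)
  moreover have "(\<Sum>i<n. parity_count (prod.swap (z i)) (prod.swap (z (Suc i)))) = 0"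
    by (rule count[of "\<lambda>p. \<chi> i. if i = 1 then p$2 else p$1"])
      (simp_all add: orient_def cross2_def)
  ultimately have "(\<Sum>i<n. weighted_count (z i) (z (Suc i))) = 0"
    by (simp add: weighted_count_def sum.distrib sum_distrib_left[symmetric])
  moreover obtain P where "partition_on {..<n} P"
    and pair: "\<forall>p\<in>P. \<exists>i j. i \<noteq> j \<and> p = {i, j} \<and> edge_vec vs j = - edge_vec vs i"
    using assms(2) unfolding balanced_def n_def by blast
  moreover have "\<forall>p\<in>P. \<exists>i j. i \<noteq> j \<and> p = {i, j} \<and> z (Suc j) - z j = - (z (Suc i) - z i)"
  proof
    fix p assume "p \<in> P"
    then obtain i j where ij: "i \<noteq> j" "p = {i, j}" "edge_vec vs j = - edge_vec vs i" using pair by blast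
    have "i < n" "j < n" using \<open>partition_on {..<n} P\<close> \<open>p \<in> P\<close> ij(2) by (auto simp: partition_on_def)
    have "nxt vs j - vs ! j = - (nxt vs i - vs ! i)" using ij(3) by (simp add: edge_vec_def nxt_def)
    then have "(nxt vs j - vs ! j) $ l = (- (nxt vs i - vs ! i)) $ l" for l by simp
    from this[of 1] this[of 2] have "z (Suc j) - z j = - (z (Suc i) - z i)"
      by (simp add: zw zi \<open>i < n\<close> \<open>j < n\<close> prod_eq_iff of_int_eq_iff[symmetric, where ?'a = real] del: of_int_eq_iff)
    then show "\<exists>i j. i \<noteq> j \<and> p = {i, j} \<and> z (Suc j) - z j = - (z (Suc i) - z i)" using ij by blast
  qed
  ultimately have "4 dvd (\<Sum>i<n. int_cross (z i) (z (Suc i)))"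
    using balanced_closed_path[of n P z] by simp
  then obtain l where l: "(\<Sum>i<n. int_cross (z i) (z (Suc i))) = 4 * l" by (elim dvdE)
  have "Sh = real_of_int (\<Sum>i<n. int_cross (z i) (z (Suc i)))"
    unfolding Sh_def of_int_sum by (rule sum.cong) (simp_all add: cross2_def int_cross_def zi zw)
  \<comment> \<open>The area is, up to the sign \<open>s\<close>, half of a multiple of 4 and
    therefore even.\<close>
  then have "real_of_int k = s * (2 * real_of_int l)" using area_Sh l by simp
  with s have "real_of_int k = real_of_int (- 2 * l) \<or> real_of_int k = real_of_int 0 \<or> real_of_int k = real_of_int (2 * l)"
    by auto
  then have "k = - 2 * l \<or> k = 0 \<or> k = 2 * l" by (simp only: of_int_eq_iff)
  then show False using k(1) by auto
qed

end
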